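(* Let $0<p<1$, $A\in\mathbb{R}^{m\times n}$, $b\in\mathbb{R}^m$, $\mu>0$, and let $F(x):=\|Ax-b\|_2^2+\mu\|x\|_p^p$ for $x\in\mathbb{R}^n$, where $\|x\|_p^p:=\sum_{i=1}^n|x_i|^p$. Let $\bar x\in\mathbb{R}^n\setminus\{0\}$, $I:=\mathrm{supp}(\bar x)=\{i\mid\bar x_i\neq0\}$, $\bar x_I:=(\bar x_i)_{i\in I}$, let $A_I:=[A_i]_{i\in I}$ with $A_i$ the $i$-th column of $A$, and define $F_I:\mathbb{R}^{|I|}\to\mathbb{R}$ by $F_I(y):=\|A_Iy-b\|^2+\mu\|y\|_p^p$. The following hold: (a) $\mathrm{KL}(F,\bar x,\theta)=\mathrm{KL}(F_I,\bar x_I,\theta)$ for all $\theta\in[0,1)$. (b) If $\nabla F_I(\bar x_I)=0$ and $\nabla^2F_I(\bar x_I)$ is negative definite, then $\partial^{>}F(\bar x)=\emptyset$ and $F$ satisfies the KL property at $\bar x$ with exponent $0$, which is not sharp. (c) If $\nabla F_I(\bar x_I)=0$ and $\nabla^2F_I(\bar x_I)$ is positive definite or indefinite, then $F$ satisfies the KL property at $\bar x$ with a sharp exponent $\frac12$, and in this case $\mathrm{KL}(F,\bar x,\frac12)=\sqrt{\frac{\lambda_{\min}}{2}}$, where $\lambda_{\min}$ is the smallest positive eigenvalue of $\nabla^2F_I(\bar x_I)$.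
   Context: $d(v,A)=\inf_{a\in A}\|a-v\|$, with $d(v,\emptyset)=+\infty$. Subgradients. Let $\varphi(x)$ be finite. $v\in\widehat\partial\varphi(x)$ if $\varphi(y)\ge\varphi(x)+\langle v,y-x\rangle+o(\|y-x\|)$. $v\in\partial\varphi(x)$ (limiting) if there are $x_k\to x$, $v_k\to v$ with $\varphi(x_k)\to\varphi(x)$ and $v_k\in\widehat\partial\varphi(x_k)$. $v\in\partial^{>}\varphi(x)$ (outer limiting) if there are $x_k\to x$, $v_k\to v$ with $\varphi(x_k)\to\varphi(x)$, $\varphi(x_k)>\varphi(x)$ and $v_k\in\partial\varphi(x_k)$. KL property. $\varphi$ satisfies the KL (Kurdyka-Łojasiewicz) property at $\bar x$ with exponent $\theta\in[0,1)$ if there exist a modulus $\sigma>0$, $\epsilon>0$, $\nu\in(0,+\infty]$ such that $d(0,\partial\varphi(x))\ge\frac{\sigma}{1-\theta}(\varphi(x)-\varphi(\bar x))^{\theta}$ whenever $\|x-\bar x\|\le\epsilon$ and $\varphi(\bar x)<\varphi(x)<\varphi(\bar x)+\nu$. $\mathrm{KL}(\varphi,\bar x,\theta)$ is the supremum of all such $\sigma$ ($\sup\emptyset:=0$); equivalently the liminf of $\frac{(1-\theta)d(0,\partial\varphi(x))}{(\varphi(x)-\varphi(\bar x))^{\theta}}$ as $x\to\bar x$, $\varphi(x)\to\varphi(\bar x)$, $\varphi(x)>\varphi(\bar x)$ ($+\infty$ if there are no such sequences). An exponent $\theta\in(0,1)$ is sharp if $\varphi$ satisfies the KL property at $\bar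 x$ with exponent $\theta$ but not with any exponent $\theta'\in[0,\theta)$. The exponent $0$ is sharp if $\varphi$ satisfies the KL property at $\bar x$ with exponent $0$ and $\partial^{>}\varphi(\bar x)\neq\emptyset$.
   Formalization: In (c), the indefinite case additionally assumes that the Hessian of F_I at x̄_I is nonsingular; for a singular Hessian with eigenvalues of both signs the claim with exponent 1/2 can fail. *)

theory Defs
  imports "HOL-Analysis.Analysis" "HOL-Library.Landau_Symbols"
begin

(* Unlike infdist, this is infinite for the empty set: the infimum of the empty
   set of extended reals is top. *)
definition edist_set :: "'a::real_normed_vector \<Rightarrow> 'a set \<Rightarrow> ereal" where
  "edist_set v A = (INF a\<in>A. ereal (norm (a - v)))"

definition regular_subdiff :: "('a::euclidean_space \<Rightarrow> real) \<Rightarrow> 'a \<Rightarrow> 'a set" where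
  "regular_subdiff \<phi> x =
     {v. \<exists>r. r \<in> o[at x](\<lambda>y. norm (y - x)) \<and> (\<forall>y. \<phi> y \<ge> \<phi> x + inner v (y - x) + r y)}"

definition limiting_subdiff :: "('a::euclidean_space \<Rightarrow> real) \<Rightarrow> 'a \<Rightarrow> 'a set" where
  "limiting_subdiff \<phi> x =
     {v. \<exists>X V. X \<longlonglongrightarrow> x \<and> V \<longlonglongrightarrow> v \<and> (\<lambda>k. \<phi> (X k)) \<longlonglongrightarrow> \<phi> x \<and>
               (\<forall>k. V k \<in> regular_subdiff \<phi> (X k))}"

definition outer_limiting_subdiff :: "('a::euclidean_space \<Rightarrow> real) \<Rightarrow> 'a \<Rightarrow> 'a set" where
  "outer_limiting_subdiff \<phi> x =
     {v. \<exists>X V. X \<longlonglongrightarrow> x \<and> V \<longlonglongrightarrow> v \<and> (\<lambda>k. \<phi> (X k)) \<longlonglongrightarrow> \<phi> x \<and>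
               (\<forall>k. \<phi> (X k) > \<phi> x \<and> V k \<in> limiting_subdiff \<phi> (X k))}"

(* The base of powr is positive here, so for \<theta> = 0 the power equals 1. *)
definition KL_with_modulus ::
    "('a::euclidean_space \<Rightarrow> real) \<Rightarrow> 'a \<Rightarrow> real \<Rightarrow> real \<Rightarrow> bool" where
  "KL_with_modulus \<phi> xb \<theta> \<sigma> \<longleftrightarrow>
     \<sigma> > 0 \<and>
     (\<exists>\<epsilon>::real. \<exists>\<nu>::ereal. \<epsilon> > 0 \<and> \<nu> > 0 \<and>
       (\<forall>x. norm (x - xb) \<le> \<epsilon> \<and> \<phi> xb < \<phi> x \<and> ereal (\<phi> x) < ereal (\<phi> xb) + \<nu> \<longrightarrow>
            edist_set 0 (limiting_subdiff \<phi> x)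
              \<ge> ereal (\<sigma> / (1 - \<theta>) * (\<phi> x - \<phi> xb) powr \<theta>)))"

definition KL_property :: "('a::euclidean_space \<Rightarrow> real) \<Rightarrow> 'a \<Rightarrow> real \<Rightarrow> bool" where
  "KL_property \<phi> xb \<theta> \<longleftrightarrow> 0 \<le> \<theta> \<and> \<theta> < 1 \<and> (\<exists>\<sigma>. KL_with_modulus \<phi> xb \<theta> \<sigma>)"

(* Every modulus is positive, so inserting 0 only implements the convention
   that the supremum of the empty set is 0 (it would be -\<infinity> in ereal). *)
definition KL :: "('a::euclidean_space \<Rightarrow> real) \<Rightarrow> 'a \<Rightarrow> real \<Rightarrow> ereal" where
  "KL \<phi> xb \<theta> = Sup (insert 0 (ereal ` {\<sigma>. KL_with_modulus \<phi> xb \<theta> \<sigma>}))"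

definition sharp_KL_exponent :: "('a::euclidean_space \<Rightarrow> real) \<Rightarrow> 'a \<Rightarrow> real \<Rightarrow> bool" where
  "sharp_KL_exponent \<phi> xb \<theta> \<longleftrightarrow>
     KL_property \<phi> xb \<theta> \<and>
     (if \<theta> = 0 then outer_limiting_subdiff \<phi> xb \<noteq> {}
      else \<forall>\<theta>'\<in>{0..<\<theta>}. \<not> KL_property \<phi> xb \<theta>')"

definition gradient :: "('a::real_inner \<Rightarrow> real) \<Rightarrow> 'a \<Rightarrow> 'a" where
  "gradient f x = (THE D. GDERIV f x :> D)"

definition hessian :: "(real^'n \<Rightarrow> real) \<Rightarrow> real^'n \<Rightarrow> real^'n^'n" where
  "hessian f x = jacobian (gradient f) (at x)"

definition positive_definite :: "real^'n^'n \<Rightarrow> bool" where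
  "positive_definite M \<longleftrightarrow> (\<forall>x. x \<noteq> 0 \<longrightarrow> inner x (M *v x) > 0)"

definition negative_definite :: "real^'n^'n \<Rightarrow> bool" where
  "negative_definite M \<longleftrightarrow> (\<forall>x. x \<noteq> 0 \<longrightarrow> inner x (M *v x) < 0)"

definition indefinite :: "real^'n^'n \<Rightarrow> bool" where
  "indefinite M \<longleftrightarrow> (\<exists>x. inner x (M *v x) > 0) \<and> (\<exists>x. inner x (M *v x) < 0)"

definition eigenvalue_of :: "real^'n^'n \<Rightarrow> real \<Rightarrow> bool" where
  "eigenvalue_of M l \<longleftrightarrow> (\<exists>v. v \<noteq> 0 \<and> M *v v = l *\<^sub>R v)"

definition smallest_pos_eigenvalue :: "real^'n^'n \<Rightarrow> real" where
  "smallest_pos_eigenvalue M = Min {l. eigenvalue_of M l \<and> l > 0}"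

definition supp :: "real^'n \<Rightarrow> 'n set" where
  "supp x = {i. x $ i \<noteq> 0}"

(* Since 0 powr p = 0, zero components contribute 0. *)
definition lp_pow :: "real \<Rightarrow> real^'n \<Rightarrow> real" where
  "lp_pow p x = (\<Sum>i\<in>UNIV. \<bar>x $ i\<bar> powr p)"

definition lp_least_squares ::
    "real^'n^'m \<Rightarrow> real^'m \<Rightarrow> real \<Rightarrow> real \<Rightarrow> real^'n \<Rightarrow> real" where
  "lp_least_squares A b \<mu> p x = (norm (A *v x - b))\<^sup>2 + \<mu> * lp_pow p x"

(* An index set I of cardinality CARD('k) is given by an injective enumeration
   e :: 'k \<Rightarrow> 'n with range I, which identifies the space of vectors indexed
   by I with real^'k. *)
definition subvector :: "('k \<Rightarrow> 'n) \<Rightarrow> real^'n \<Rightarrow> real^'k" where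
  "subvector e x = (\<chi> j. x $ e j)"

definition column_submatrix :: "('k \<Rightarrow> 'n) \<Rightarrow> real^'n^'m \<Rightarrow> real^'k^'m" where
  "column_submatrix e A = (\<chi> i j. A $ i $ e j)"

end

theory Submission
  imports Defs
begin

text \<open>
  Write \<open>S\<close> for the support of a point \<open>x\<close>. Fixing the zero coordinates of \<open>x\<close> leaves a
  function that is smooth at \<open>x\<close>; the discarded terms \<open>\<mu> * \<bar>y $ i\<bar> powr p\<close> have a vertical cusp
  at \<open>0\<close>, which supports every slope. Hence the subgradients of the objective at \<open>x\<close> are the
  vectors whose entries on \<open>S\<close> are the classical partial derivatives and whose other entries are
  arbitrary (\<open>limiting_subdiff_lp_least_squares\<close>), and the distance of \<open>0\<close> to the
  subdifferential is the norm of the vector of partial derivatives on \<open>S\<close>.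

  Near \<open>xb\<close> there are then two kinds of points. If the support of \<open>x\<close> is that of \<open>xb\<close>, then \<open>x\<close>
  is a point of the coordinate subspace, where the objective and its restriction to this subspace
  have equal values and equal subgradient norms. Otherwise some entry of \<open>x\<close> is tiny but not
  zero, and its partial derivative is of the order of \<open>\<bar>x $ i\<bar> powr (p - 1)\<close>, hence arbitrarily
  large (\<open>min_subgrad_blowup\<close>), so the KL inequality holds there whatever the modulus. So the
  objective and its restriction have exactly the same KL moduli
  (\<open>KL_with_modulus_lp_least_squares_reduction\<close>), and the remaining claims concern a function
  that is twice differentiable at its critical point.

  There \<open>G (xb + h) = H h + o(\<bar>h\<bar>)\<close> for the gradient and
  \<open>f (xb + h) - f xb = h \<bullet> H h / 2 + o(\<bar>h\<bar>\<^sup>2)\<close>. If \<open>H\<close> is negative definite, no nearby value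
  exceeds \<open>f xb\<close>, so the KL inequality is vacuous; an outer limiting subgradient of the full
  objective would have to come from points with larger support, where subgradients are unbounded.
  If \<open>H\<close> is invertible with smallest positive eigenvalue \<open>\<kappa>\<close>, then \<open>\<kappa> * (h \<bullet> H h) \<le> \<bar>H h\<bar>\<^sup>2\<close>
  (\<open>selfadjoint_spectral_gap\<close>), which gives the KL inequality with exponent \<open>1/2\<close> for every
  modulus below \<open>sqrt (\<kappa> / 2)\<close>. Along an eigenvector for \<open>\<kappa>\<close> the inequality is asymptotically an
  equality for \<open>sqrt (\<kappa> / 2)\<close>, and it fails for exponents below \<open>1/2\<close>.
\<close>

section \<open>Spectral facts about self-adjoint operators\<close>

text \<open>A zero of a nonnegative quadratic form is a minimum, so the gradient \<open>2 * T v\<close> of the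
  form vanishes there.\<close>
lemma psd_form_zero_imp_kernel:
  fixes T :: "'a::real_inner \<Rightarrow> 'a"
  assumes lin: "linear T" and sym: "\<And>x y. T x \<bullet> y = x \<bullet> T y"
    and psd: "\<And>x. 0 \<le> x \<bullet> T x" and v: "v \<bullet> T v = 0"
  shows "T v = 0"
proof -
  define N where "N = T v \<bullet> T v"
  define Q where "Q = T v \<bullet> T (T v)"
  have Q0: "Q \<ge> 0" using psd Q_def by simp
  have N0: "N \<ge> 0" unfolding N_def by simp
  \<comment> \<open>along the ray \<open>v - s *\<^sub>R T v\<close> the form is \<open>s * (s * Q - 2 * N)\<close>,
      negative for small \<open>s > 0\<close> unless \<open>N = 0\<close>\<close>
  have exp: "(v - s *\<^sub>R T v) \<bullet> T (v - s *\<^sub>R T v) = s * (s * Q - 2 * N)" for s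
    using v sym[of v "T v"]
    by (simp add: linear_diff[OF lin] linear_scale[OF lin] inner_diff_left inner_diff_right
        N_def Q_def algebra_simps)
  define s where "s = N / (Q + 1)"
  have "N = 0"
  proof (rule ccontr)
    assume "N \<noteq> 0"
    hence Np: "N > 0" using N0 by simp
    have sp: "s > 0" using Np Q0 by (simp add: s_def)
    have "s * Q \<le> N" using Q0 Np by (simp add: s_def field_simps)
    hence "s * (s * Q - 2 * N) < 0" using sp Np by (intro mult_pos_neg) auto
    moreover have "s * (s * Q - 2 * N) \<ge> 0" using psd exp by metis
    ultimately show False by simp
  qed
  thus ?thesis by (simp add: N_def)
qed

text \<open>The least eigenvalue is the minimum of the Rayleigh quotient over the unit sphere; a
  minimizer is a zero of the nonnegative form of \<open>T - m\<close>.\<close>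
lemma selfadjoint_least_eigenvalue:
  fixes T :: "'a::euclidean_space \<Rightarrow> 'a"
  assumes lin: "linear T" and sym: "\<And>x y. T x \<bullet> y = x \<bullet> T y"
  obtains v m where "norm v = 1" "T v = m *\<^sub>R v" "\<And>x. m * (x \<bullet> x) \<le> x \<bullet> T x"
proof -
  have cont: "continuous_on (sphere 0 1) (\<lambda>x. x \<bullet> T x)"
    using lin by (intro continuous_on_inner continuous_on_id linear_continuous_on)
      (simp add: linear_conv_bounded_linear)
  have "sphere (0::'a) 1 \<noteq> {}" by simp
  then obtain v where v: "v \<in> sphere 0 1" and min: "\<And>y. y \<in> sphere 0 1 \<Longrightarrow> v \<bullet> T v \<le> y \<bullet> T y"
    using continuous_attains_inf[OF compact_sphere _ cont] by blast
  define m where "m = v \<bullet> T v"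
  have n1: "norm v = 1" using v by simp
  have low: "m * (x \<bullet> x) \<le> x \<bullet> T x" for x
  proof (cases "x = 0")
    case True then show ?thesis by simp
  next
    case False
    define u where "u = (1 / norm x) *\<^sub>R x"
    have "u \<in> sphere 0 1" using False by (simp add: u_def)
    hence "m \<le> u \<bullet> T u" using min m_def by simp
    also have "u \<bullet> T u = (x \<bullet> T x) / (x \<bullet> x)"
      by (simp add: u_def linear_scale[OF lin] power2_norm_eq_inner[symmetric] power2_eq_square)
    finally show ?thesis using False by (simp add: field_simps)
  qed
  define S where "S = (\<lambda>x. T x - m *\<^sub>R x)"
  have "S v = 0"
  proof (rule psd_form_zero_imp_kernel[of S v])
    show "linear S" unfolding S_def by (intro linear_compose_sub lin linear_scaleR)
    show "S x \<bullet> y = x \<bullet> S y" for x y by (simp add: S_def inner_diff_left inner_diff_right sym)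
    show "0 \<le> x \<bullet> S x" for x using low[of x] by (simp add: S_def inner_diff_right)
    show "v \<bullet> S v = 0" using n1 by (simp add: S_def inner_diff_right m_def norm_eq_1)
  qed
  hence "T v = m *\<^sub>R v" by (simp add: S_def)
  from that[OF n1 this low] show thesis .
qed

lemma selfadjoint_positive_eigenvalue_exists:
  fixes T :: "'a::euclidean_space \<Rightarrow> 'a"
  assumes lin: "linear T" and sym: "\<And>x y. T x \<bullet> y = x \<bullet> T y" and pos: "0 < z \<bullet> T z"
  obtains v l where "v \<noteq> 0" "T v = l *\<^sub>R v" "0 < l"
proof -
  have "linear (\<lambda>x. - T x)" using lin by (rule linear_compose_neg)
  then obtain v m where v: "norm v = 1" "- T v = m *\<^sub>R v"
      and low: "\<And>x. m * (x \<bullet> x) \<le> x \<bullet> (- T x)"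
    by (rule selfadjoint_least_eigenvalue) (auto simp: sym)
  have z: "z \<noteq> 0" using pos by auto
  have "m * (z \<bullet> z) < 0" using low[of z] pos by simp
  moreover have "0 < z \<bullet> z" using z by simp
  ultimately have "m < 0" by (simp add: mult_less_0_iff)
  moreover have "T v = (- m) *\<^sub>R v" using v(2) by (simp add: minus_equation_iff[of "T v"])
  moreover have "v \<noteq> 0" using v(1) by auto
  ultimately show thesis using that[of v "-m"] by simp
qed

text \<open>In an eigenbasis this is \<open>l\<^sup>2 \<ge> \<kappa> * l\<close> for every eigenvalue \<open>l\<close>. Without diagonalizing: let
  \<open>m\<close> be the least eigenvalue of \<open>T\<^sup>2 - \<kappa> * T\<close>, with eigenvector \<open>v\<close>. If \<open>m < 0\<close>, then
  \<open>T\<^sup>2 - \<kappa> * T - m\<close> annihilates \<open>v\<close>. Either this polynomial has no real root, and then it is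
  the square of a self-adjoint operator plus a positive multiple of the identity, which is
  injective; or it splits into factors \<open>T - r1\<close> and
  \<open>T - r2\<close> with \<open>r1\<close> and \<open>r2\<close> in \<open>(0, \<kappa>)\<close>, one of which is an eigenvalue of \<open>T\<close>.\<close>
lemma selfadjoint_spectral_gap:
  fixes T :: "'a::euclidean_space \<Rightarrow> 'a"
  assumes lin: "linear T" and sym: "\<And>x y. T x \<bullet> y = x \<bullet> T y"
    and lpos: "0 < \<kappa>"
    and gap: "\<And>l v. 0 < l \<Longrightarrow> l < \<kappa> \<Longrightarrow> v \<noteq> 0 \<Longrightarrow> T v \<noteq> l *\<^sub>R v"
  shows "\<kappa> * (x \<bullet> T x) \<le> (norm (T x))\<^sup>2"
proof -
  define S where "S = (\<lambda>x. T (T x) - \<kappa> *\<^sub>R T x)"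
  have linS: "linear S"
    unfolding S_def using lin
    by (intro linear_compose_sub linear_compose[of T T, unfolded o_def] linear_compose_scale_right)
  have symS: "S x \<bullet> y = x \<bullet> S y" for x y
    by (simp add: S_def inner_diff_left inner_diff_right sym)
  obtain v m where v: "norm v = 1" and Sv: "S v = m *\<^sub>R v"
    and low: "\<And>x. m * (x \<bullet> x) \<le> x \<bullet> S x"
    by (rule selfadjoint_least_eigenvalue[OF linS symS]) auto
  have v0: "v \<noteq> 0" using v by auto
  have "m \<ge> 0"
  proof (rule ccontr)
    assume "\<not> m \<ge> 0"
    hence m: "m < 0" by simp
    define \<Delta> where "\<Delta> = \<kappa>\<^sup>2 / 4 + m"
    show False
    proof (cases "\<Delta> < 0")
      case True
      have "(T v - (\<kappa>/2) *\<^sub>R v) \<bullet> (T v - (\<kappa>/2) *\<^sub>R v) = v \<bullet> S v + \<kappa>\<^sup>2/4 * (v \<bullet> v)"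
        using sym[of v "T v"]
        by (simp add: S_def inner_diff_left inner_diff_right inner_commute[of "T v" v]
            power2_eq_square field_simps)
      also have "\<dots> = \<Delta>" using v by (simp add: Sv \<Delta>_def norm_eq_1)
      finally show False using True inner_ge_zero[of "T v - (\<kappa>/2) *\<^sub>R v"] by linarith
    next
      case False
      define d where "d = sqrt \<Delta>"
      have d2: "d * d = \<Delta>" and d0: "d \<ge> 0" using False by (simp_all add: d_def)
      have "d * d < (\<bar>\<kappa>\<bar>/2) * (\<bar>\<kappa>\<bar>/2)" using m by (simp add: d2 \<Delta>_def power2_eq_square)
      hence dl: "d < \<bar>\<kappa>\<bar> / 2" by (meson d0 abs_ge_zero divide_nonneg_nonneg mult_mono not_le zero_le_numeral)
      define r1 r2 where "r1 = \<kappa>/2 - d" and "r2 = \<kappa>/2 + d"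
      define w where "w = T v - r2 *\<^sub>R v"
      show False
      proof -
        have r: "0 < r1" "r1 < \<kappa>" "0 < r2" "r2 < \<kappa>"
          using dl d0 lpos by (simp_all add: r1_def r2_def)
        have w0: "w \<noteq> 0" using gap[OF r(3,4) v0] by (simp add: w_def)
        have p: "r1 * r2 = - m" and s: "r1 + r2 = \<kappa>"
          using d2 by (simp_all add: r1_def r2_def \<Delta>_def algebra_simps power2_eq_square)
        have "T w - r1 *\<^sub>R w = T (T v) - (r1 + r2) *\<^sub>R T v + (r1 * r2) *\<^sub>R v"
          by (simp add: w_def linear_diff[OF lin] linear_scale[OF lin] algebra_simps)
        also have "\<dots> = S v - m *\<^sub>R v" by (simp add: p s S_def)
        also have "\<dots> = 0" by (simp add: Sv)
        finally show False using gap[OF r(1,2) w0] by simp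
      qed
    qed
  qed
  have "0 \<le> m * (x \<bullet> x)" using \<open>m \<ge> 0\<close> by simp
  also have "\<dots> \<le> x \<bullet> S x" by (rule low)
  also have "x \<bullet> S x = (norm (T x))\<^sup>2 - \<kappa> * (x \<bullet> T x)"
    by (simp add: S_def inner_diff_right sym power2_norm_eq_inner)
  finally show ?thesis by simp
qed

text \<open>Eigenvectors for distinct eigenvalues are orthogonal, so there are at most as many
  eigenvalues as dimensions.\<close>
lemma selfadjoint_finite_eigenvalues:
  fixes T :: "'a::euclidean_space \<Rightarrow> 'a"
  assumes sym: "\<And>x y. T x \<bullet> y = x \<bullet> T y"
  shows "finite {l. \<exists>v. v \<noteq> 0 \<and> T v = l *\<^sub>R v}"
proof -
  define L where "L = {l. \<exists>v. v \<noteq> 0 \<and> T v = l *\<^sub>R v}"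
  define V where "V = (\<lambda>l. SOME v. v \<noteq> 0 \<and> T v = l *\<^sub>R v)"
  have V: "V l \<noteq> 0 \<and> T (V l) = l *\<^sub>R V l" if "l \<in> L" for l
    unfolding V_def
    by (rule someI_ex[of "\<lambda>v. v \<noteq> 0 \<and> T v = l *\<^sub>R v"]) (use that in \<open>simp add: L_def\<close>)
  have orth: "V l \<bullet> V k = 0" if "l \<in> L" "k \<in> L" "l \<noteq> k" for l k
  proof -
    have "T (V l) \<bullet> V k = V l \<bullet> T (V k)" by (rule sym)
    hence "(l - k) * (V l \<bullet> V k) = 0" using V that by (simp add: algebra_simps)
    thus ?thesis using that by simp
  qed
  have inj: "inj_on V L"
  proof (rule inj_onI, rule ccontr)
    fix l k assume lk: "l \<in> L" "k \<in> L" "V l = V k" "l \<noteq> k"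
    then have "V l \<bullet> V l = 0" using orth[of l k] by simp
    then show False using V[OF lk(1)] by simp
  qed
  have "pairwise orthogonal (V ` L)"
    unfolding pairwise_def orthogonal_def using orth by blast
  hence "finite (V ` L)" by (rule pairwise_orthogonal_imp_finite)
  hence "finite L" using inj by (rule finite_imageD)
  thus ?thesis by (simp add: L_def)
qed

section \<open>Second-order behaviour at a critical point\<close>

lemma gradient_taylor1:
  fixes G :: "'a::real_normed_vector \<Rightarrow> 'b::real_normed_vector"
  assumes "(G has_derivative T) (at xb)" and "G xb = 0" and "0 < \<epsilon>"
  shows "\<forall>\<^sub>F x in nhds xb. norm (G x - T (x - xb)) \<le> \<epsilon> * norm (x - xb)"
proof -
  obtain d where "d > 0" and
    "\<And>y. norm (y - xb) < d \<Longrightarrow> norm (G y - G xb - T (y - xb)) \<le> \<epsilon> * norm (y - xb)"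
    using assms unfolding has_derivative_at_alt by blast
  thus ?thesis unfolding eventually_nhds_metric dist_norm \<open>G xb = 0\<close> by auto
qed

text \<open>The mean value theorem on the segment from \<open>xb\<close> to \<open>x\<close>, applied to \<open>f\<close> minus half the
  quadratic form, reduces the claim to the first-order expansion of the gradient.\<close>
lemma critical_point_taylor2:
  fixes f :: "'a::real_inner \<Rightarrow> real"
  assumes grad: "\<forall>\<^sub>F x in nhds xb. GDERIV f x :> G x"
    and der: "(G has_derivative T) (at xb)" and crit: "G xb = 0" and eps: "0 < \<epsilon>"
  shows "\<forall>\<^sub>F x in nhds xb. \<bar>f x - f xb - ((x - xb) \<bullet> T (x - xb)) / 2\<bar> \<le> \<epsilon> * (norm (x - xb))\<^sup>2"
proof -
  have lin: "linear T" using der has_derivative_linear by blast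
  have "\<forall>\<^sub>F x in nhds xb. GDERIV f x :> G x \<and> norm (G x - T (x - xb)) \<le> \<epsilon> * norm (x - xb)"
    using grad gradient_taylor1[OF der crit eps] by (rule eventually_conj)
  then obtain d where d: "d > 0" and
      D: "\<And>x. dist x xb < d \<Longrightarrow> GDERIV f x :> G x \<and> norm (G x - T (x - xb)) \<le> \<epsilon> * norm (x - xb)"
    unfolding eventually_nhds_metric by blast
  have "\<bar>f x - f xb - ((x - xb) \<bullet> T (x - xb)) / 2\<bar> \<le> \<epsilon> * (norm (x - xb))\<^sup>2" if x: "dist x xb < d" for x
  proof -
    define h where "h = x - xb"
    have nh: "norm h < d" using x by (simp add: h_def dist_norm)
    define g where "g = (\<lambda>t. f (xb + t *\<^sub>R h) - t\<^sup>2 / 2 * (h \<bullet> T h))"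
    have near: "dist (xb + t *\<^sub>R h) xb < d" if "0 \<le> t" "t \<le> 1" for t
      using that nh mult_left_le_one_le[of "norm h" t] by (simp add: dist_norm)
    have der_g: "(g has_real_derivative (h \<bullet> G (xb + t *\<^sub>R h) - t * (h \<bullet> T h))) (at t)"
      if t: "0 \<le> t" "t \<le> 1" for t
    proof -
      have "(f has_derivative (\<lambda>k. k \<bullet> G (xb + t *\<^sub>R h))) (at (xb + t *\<^sub>R h))"
        using D[OF near[OF t]] by (simp add: gderiv_def)
      moreover have "((\<lambda>t. xb + t *\<^sub>R h) has_derivative (\<lambda>s. s *\<^sub>R h)) (at t)"
        by (auto intro!: derivative_eq_intros)
      ultimately have "((\<lambda>t. f (xb + t *\<^sub>R h)) has_derivative (\<lambda>s. (s *\<^sub>R h) \<bullet> G (xb + t *\<^sub>R h))) (at t)"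
        by (rule has_derivative_compose[rotated])
      hence "((\<lambda>t. f (xb + t *\<^sub>R h)) has_real_derivative (h \<bullet> G (xb + t *\<^sub>R h))) (at t)"
        by (simp add: has_field_derivative_def mult_commute_abs)
      thus ?thesis unfolding g_def by (auto intro!: derivative_eq_intros)
    qed
    have "\<exists>z>0. z < 1 \<and> g 1 - g 0 = (1 - 0) * (h \<bullet> G (xb + z *\<^sub>R h) - z * (h \<bullet> T h))"
      using MVT2[of 0 1 g "\<lambda>t. h \<bullet> G (xb + t *\<^sub>R h) - t * (h \<bullet> T h)"] der_g by auto
    then obtain z where z: "0 < z" "z < 1" and
        eq: "g 1 - g 0 = h \<bullet> G (xb + z *\<^sub>R h) - z * (h \<bullet> T h)" by auto
    have "h \<bullet> G (xb + z *\<^sub>R h) - z * (h \<bullet> T h) = h \<bullet> (G (xb + z *\<^sub>R h) - T (z *\<^sub>R h))"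
      by (simp add: inner_diff_right linear_scale[OF lin])
    also have "\<bar>\<dots>\<bar> \<le> norm h * norm (G (xb + z *\<^sub>R h) - T (z *\<^sub>R h))"
      by (rule Cauchy_Schwarz_ineq2)
    also have "\<dots> \<le> norm h * (\<epsilon> * norm (z *\<^sub>R h))"
      using D[OF near[of z]] z by (intro mult_left_mono) auto
    also have "\<dots> \<le> norm h * (\<epsilon> * norm h)"
      using z eps by (intro mult_left_mono) (auto intro!: mult_left_le_one_le)
    finally have "\<bar>g 1 - g 0\<bar> \<le> \<epsilon> * (norm h)\<^sup>2"
      by (simp add: eq power2_eq_square mult.left_commute)
    moreover have "g 1 - g 0 = f x - f xb - (h \<bullet> T h) / 2" by (simp add: g_def h_def)
    ultimately show ?thesis by (simp add: h_def)
  qed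
  thus ?thesis using d unfolding eventually_nhds_metric by blast
qed

text \<open>The quadratic form is bounded above by \<open>- m * (norm h)\<^sup>2\<close> with \<open>m > 0\<close>, which dominates the
  Taylor remainder.\<close>
lemma negative_definite_critical_local_max:
  fixes f :: "'a::euclidean_space \<Rightarrow> real"
  assumes grad: "\<forall>\<^sub>F x in nhds xb. GDERIV f x :> G x"
    and der: "(G has_derivative T) (at xb)" and crit: "G xb = 0"
    and sym: "\<And>x y. T x \<bullet> y = x \<bullet> T y"
    and neg: "\<And>x. x \<noteq> 0 \<Longrightarrow> x \<bullet> T x < 0"
  shows "\<forall>\<^sub>F x in nhds xb. f x \<le> f xb"
proof -
  have lin: "linear T" using der has_derivative_linear by blast
  have "linear (\<lambda>x. - T x)" using lin by (rule linear_compose_neg)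
  then obtain v m where v: "norm v = 1" "- T v = m *\<^sub>R v"
      and low: "\<And>x. m * (x \<bullet> x) \<le> x \<bullet> (- T x)"
    by (rule selfadjoint_least_eigenvalue) (auto simp: sym)
  have "v \<bullet> (- T v) = m" using v by (simp add: norm_eq_1)
  moreover have "v \<noteq> 0" using v by auto
  ultimately have m: "m > 0" using neg[of v] by simp
  hence "0 < m/2" by simp
  from critical_point_taylor2[OF grad der crit this]
  show ?thesis
  proof eventually_elim
    case (elim x)
    have "m * (norm (x - xb))\<^sup>2 \<le> - ((x - xb) \<bullet> T (x - xb))"
      using low[of "x - xb"] by (simp add: power2_norm_eq_inner)
    thus ?case using elim unfolding abs_le_iff by linarith
  qed
qed

section \<open>The KL modulus at a nondegenerate critical point\<close>

text \<open>For a function continuous at \<open>xb\<close> the value window \<open>\<nu>\<close> can be absorbed into the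
  neighbourhood, which turns the KL inequality into a property of all points near \<open>xb\<close>.\<close>
lemma KL_with_modulus_iff_eventually:
  assumes cont: "isCont \<phi> xb"
  shows "KL_with_modulus \<phi> xb \<theta> \<sigma> \<longleftrightarrow> 0 < \<sigma> \<and>
    (\<forall>\<^sub>F x in nhds xb. \<phi> xb < \<phi> x \<longrightarrow>
       ereal (\<sigma> / (1 - \<theta>) * (\<phi> x - \<phi> xb) powr \<theta>) \<le> edist_set 0 (limiting_subdiff \<phi> x))"
    (is "?L \<longleftrightarrow> 0 < \<sigma> \<and> ?E")
proof
  assume ?L
  then obtain \<epsilon> and \<nu> :: ereal where s: "0 < \<sigma>" and e: "0 < \<epsilon>" and n: "0 < \<nu>" and
    H: "\<And>x. norm (x - xb) \<le> \<epsilon> \<Longrightarrow> \<phi> xb < \<phi> x \<Longrightarrow> ereal (\<phi> x) < ereal (\<phi> xb) + \<nu> \<Longrightarrow>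
        ereal (\<sigma> / (1 - \<theta>) * (\<phi> x - \<phi> xb) powr \<theta>) \<le> edist_set 0 (limiting_subdiff \<phi> x)"
    unfolding KL_with_modulus_def by blast
  have "ereal (\<phi> xb) < ereal (\<phi> xb) + \<nu>" using n by (cases \<nu>) auto
  moreover have "((\<lambda>x. ereal (\<phi> x)) \<longlongrightarrow> ereal (\<phi> xb)) (nhds xb)"
    using cont by (simp add: continuous_at_imp_continuous_at_within tendsto_at_iff_tendsto_nhds isCont_def)
  ultimately have "\<forall>\<^sub>F x in nhds xb. ereal (\<phi> x) < ereal (\<phi> xb) + \<nu>"
    using order_tendstoD(2) by blast
  moreover have "\<forall>\<^sub>F x in nhds xb. norm (x - xb) \<le> \<epsilon>"
    using e unfolding eventually_nhds_metric dist_norm by (meson less_imp_le)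
  ultimately have ?E by eventually_elim (use H in blast)
  with s show "0 < \<sigma> \<and> ?E" by blast
next
  assume R: "0 < \<sigma> \<and> ?E"
  then obtain d where d: "d > 0" and
    D: "\<And>x. dist x xb < d \<Longrightarrow> \<phi> xb < \<phi> x \<Longrightarrow>
        ereal (\<sigma> / (1 - \<theta>) * (\<phi> x - \<phi> xb) powr \<theta>) \<le> edist_set 0 (limiting_subdiff \<phi> x)"
    unfolding eventually_nhds_metric by blast
  have "\<forall>x. norm (x - xb) \<le> d/2 \<and> \<phi> xb < \<phi> x \<and> ereal (\<phi> x) < ereal (\<phi> xb) + \<infinity> \<longrightarrow>
        ereal (\<sigma> / (1 - \<theta>) * (\<phi> x - \<phi> xb) powr \<theta>) \<le> edist_set 0 (limiting_subdiff \<phi> x)"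
    using D d by (auto simp: dist_norm)
  moreover have "0 < d/2" "(0::ereal) < \<infinity>" using d by simp_all
  ultimately show ?L using R unfolding KL_with_modulus_def by blast
qed

text \<open>With \<open>N = norm (T (x - xb))\<close>, injectivity of \<open>T\<close> makes both Taylor remainders small relative
  to \<open>N\<close>: the gradient norm is at least \<open>N\<close> and the value gap at most \<open>N\<^sup>2 / (2 * \<kappa>)\<close>, up to
  factors near \<open>1\<close>. The strict inequality \<open>\<sigma> < sqrt (\<kappa> / 2)\<close> leaves room for these factors.\<close>
lemma KL_half_modulus_at_nondegenerate_critical_point:
  fixes f :: "'a::euclidean_space \<Rightarrow> real"
  assumes cont: "isCont f xb"
    and grad: "\<forall>\<^sub>F x in nhds xb. GDERIV f x :> G x"
    and dist: "\<forall>\<^sub>F x in nhds xb. edist_set 0 (limiting_subdiff f x) = ereal (norm (G x))"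
    and der: "(G has_derivative T) (at xb)" and crit: "G xb = 0"
    and sym: "\<And>x y. T x \<bullet> y = x \<bullet> T y" and inj: "inj T"
    and kpos: "0 < \<kappa>"
    and gap: "\<And>l v. 0 < l \<Longrightarrow> l < \<kappa> \<Longrightarrow> v \<noteq> 0 \<Longrightarrow> T v \<noteq> l *\<^sub>R v"
    and \<sigma>: "0 < \<sigma>" "\<sigma> < sqrt (\<kappa> / 2)"
  shows "KL_with_modulus f xb (1/2) \<sigma>"
proof -
  have lin: "linear T" using der has_derivative_linear by blast
  obtain c where c: "c > 0" and Tc: "\<And>x. c * norm x \<le> norm (T x)"
    using linear_inj_bounded_below_pos[OF lin inj] by (metis mult.commute)
  \<comment> \<open>the final estimate needs \<open>key\<close> below, which holds at \<open>\<epsilon> = 0\<close> and so, by continuity,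
      for some \<open>\<epsilon> > 0\<close>\<close>
  have "\<sigma>\<^sup>2 < (sqrt (\<kappa>/2))\<^sup>2" using \<sigma> by (intro power_strict_mono) auto
  hence "4 * \<sigma>\<^sup>2 * (1 / (2*\<kappa>)) < 1" using kpos by (simp add: field_simps)
  moreover have "((\<lambda>\<epsilon>. (1 - \<epsilon>/c)\<^sup>2 - 4 * \<sigma>\<^sup>2 * (1/(2*\<kappa>) + \<epsilon>/c\<^sup>2)) \<longlongrightarrow>
      (1 - 0/c)\<^sup>2 - 4 * \<sigma>\<^sup>2 * (1/(2*\<kappa>) + 0/c\<^sup>2)) (at_right 0)"
    using c by (intro tendsto_intros) auto
  ultimately have "\<forall>\<^sub>F \<epsilon> in at_right 0. 0 < (1 - \<epsilon>/c)\<^sup>2 - 4 * \<sigma>\<^sup>2 * (1/(2*\<kappa>) + \<epsilon>/c\<^sup>2)"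
    by (intro order_tendstoD(1)) auto
  moreover have "\<forall>\<^sub>F \<epsilon> in at_right 0. \<epsilon> < c" using c by (rule eventually_at_right_real[THEN eventually_mono]) auto
  moreover have "\<forall>\<^sub>F \<epsilon> in at_right 0. (0::real) < \<epsilon>" by (rule eventually_at_right_less)
  ultimately have "\<forall>\<^sub>F \<epsilon> in at_right 0. 0 < \<epsilon> \<and> \<epsilon> < c \<and>
      0 < (1 - \<epsilon>/c)\<^sup>2 - 4 * \<sigma>\<^sup>2 * (1/(2*\<kappa>) + \<epsilon>/c\<^sup>2)" by eventually_elim auto
  then obtain \<epsilon> where e: "0 < \<epsilon>" "\<epsilon> < c" and
    key: "4 * \<sigma>\<^sup>2 * (1/(2*\<kappa>) + \<epsilon>/c\<^sup>2) < (1 - \<epsilon>/c)\<^sup>2"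
    using eventually_happens'[OF trivial_limit_at_right_real] by force
  have "\<forall>\<^sub>F x in nhds xb. f xb < f x \<longrightarrow>
     ereal (\<sigma> / (1 - 1/2) * (f x - f xb) powr (1/2)) \<le> edist_set 0 (limiting_subdiff f x)"
    using dist gradient_taylor1[OF der crit e(1)] critical_point_taylor2[OF grad der crit e(1)]
  proof eventually_elim
    case (elim x)
    define N where "N = norm (T (x - xb))"
    have N0: "N \<ge> 0" by (simp add: N_def)
    have hN: "norm (x - xb) \<le> N / c" using Tc[of "x - xb"] c by (simp add: N_def field_simps)
    have G: "(1 - \<epsilon>/c) * N \<le> norm (G x)"
    proof -
      have "N \<le> norm (G x) + norm (G x - T (x - xb))"
        unfolding N_def by (metis norm_triangle_sub norm_minus_commute)
      also have "\<dots> \<le> norm (G x) + \<epsilon> * (N / c)"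
        using elim(2) mult_left_mono[OF hN, of \<epsilon>] e by linarith
      finally show ?thesis by (simp add: algebra_simps)
    qed
    have F: "f x - f xb \<le> (1/(2*\<kappa>) + \<epsilon>/c\<^sup>2) * N\<^sup>2"
    proof -
      have "\<kappa> * ((x - xb) \<bullet> T (x - xb)) \<le> N\<^sup>2"
        unfolding N_def by (rule selfadjoint_spectral_gap[OF lin sym kpos gap])
      hence "((x - xb) \<bullet> T (x - xb)) / 2 \<le> N\<^sup>2 / (2*\<kappa>)" using kpos by (simp add: field_simps)
      moreover have "(norm (x - xb))\<^sup>2 \<le> N\<^sup>2 / c\<^sup>2"
        using power_mono[OF hN, of 2] by (simp add: power_divide)
      hence "\<epsilon> * (norm (x - xb))\<^sup>2 \<le> \<epsilon> * (N\<^sup>2 / c\<^sup>2)" using e by (intro mult_left_mono) auto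
      ultimately have "f x - f xb \<le> N\<^sup>2 / (2*\<kappa>) + \<epsilon> * (N\<^sup>2 / c\<^sup>2)"
        using elim(3) unfolding abs_le_iff by linarith
      thus ?thesis by (simp add: algebra_simps)
    qed
    show ?case
    proof
      assume "f xb < f x"
      have "(2 * \<sigma> * sqrt (f x - f xb))\<^sup>2 = 4 * \<sigma>\<^sup>2 * (f x - f xb)"
        using \<open>f xb < f x\<close> by (simp add: power_mult_distrib)
      also have "\<dots> \<le> 4 * \<sigma>\<^sup>2 * ((1/(2*\<kappa>) + \<epsilon>/c\<^sup>2) * N\<^sup>2)"
        by (intro mult_left_mono F) auto
      also have "\<dots> = (4 * \<sigma>\<^sup>2 * (1/(2*\<kappa>) + \<epsilon>/c\<^sup>2)) * N\<^sup>2" by simp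
      also have "\<dots> \<le> (1 - \<epsilon>/c)\<^sup>2 * N\<^sup>2" using key by (intro mult_right_mono) auto
      also have "\<dots> = ((1 - \<epsilon>/c) * N)\<^sup>2" by (simp add: power_mult_distrib)
      finally have "2 * \<sigma> * sqrt (f x - f xb) \<le> (1 - \<epsilon>/c) * N"
        by (rule power2_le_imp_le) (use e N0 c in simp)
      also note G
      finally show "ereal (\<sigma> / (1 - 1/2) * (f x - f xb) powr (1/2)) \<le> edist_set 0 (limiting_subdiff f x)"
        using elim(1) \<open>f xb < f x\<close> by (simp add: powr_half_sqrt mult.commute)
    qed
  qed
  thus ?thesis using \<sigma> KL_with_modulus_iff_eventually[OF cont] by blast
qed

text \<open>At \<open>xb + t *\<^sub>R u\<close>, for a unit eigenvector \<open>u\<close> and \<open>t\<close> tending to \<open>0\<close> from above, the gradient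
  norm is asymptotic to \<open>\<kappa> * t\<close> and the value gap to \<open>\<kappa> / 2 * t\<^sup>2\<close>. Dividing the KL inequality by
  \<open>t powr (2 * \<theta>)\<close> and passing to the limit bounds \<open>\<sigma>\<close> when \<open>\<theta> = 1/2\<close>; for smaller \<open>\<theta>\<close> the
  gradient side tends to \<open>0\<close> and the other side does not.\<close>
lemma KL_modulus_bound_along_eigenvector:
  fixes f :: "'a::euclidean_space \<Rightarrow> real"
  assumes cont: "isCont f xb"
    and grad: "\<forall>\<^sub>F x in nhds xb. GDERIV f x :> G x"
    and dist: "\<forall>\<^sub>F x in nhds xb. edist_set 0 (limiting_subdiff f x) = ereal (norm (G x))"
    and der: "(G has_derivative T) (at xb)" and crit: "G xb = 0"
    and ev: "v \<noteq> 0" "T v = \<kappa> *\<^sub>R v" "0 < \<kappa>"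
    and KL: "KL_with_modulus f xb \<theta> \<sigma>" and th: "0 \<le> \<theta>" "\<theta> \<le> 1/2"
  shows "\<theta> = 1/2 \<and> \<sigma> \<le> sqrt (\<kappa> / 2)"
proof -
  have lin: "linear T" using der has_derivative_linear by blast
  define u where "u = (1 / norm v) *\<^sub>R v"
  have nu: "norm u = 1" and Tu: "T u = \<kappa> *\<^sub>R u"
    using ev by (simp_all add: u_def linear_scale[OF lin])
  have uTu: "u \<bullet> T u = \<kappa>" using nu by (simp add: Tu norm_eq_1)
  define X where "X = (\<lambda>t. xb + t *\<^sub>R u)"
  have "((\<lambda>t. xb + t *\<^sub>R u) \<longlongrightarrow> xb + 0 *\<^sub>R u) (at_right 0)" by (intro tendsto_intros)
  hence X: "filterlim X (nhds xb) (at_right 0)" by (simp add: X_def)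
  have tpos: "\<forall>\<^sub>F t in at_right 0. (0::real) < t" by (rule eventually_at_right_less)
  have limG: "((\<lambda>t. norm (G (X t)) / t) \<longlongrightarrow> \<kappa>) (at_right 0)"
  proof (rule tendstoI)
    fix r :: real assume r: "0 < r"
    have "\<forall>\<^sub>F x in nhds xb. norm (G x - T (x - xb)) \<le> (r/2) * norm (x - xb)"
      using gradient_taylor1[OF der crit, of "r/2"] r by simp
    from eventually_compose_filterlim[OF this X] tpos
    show "\<forall>\<^sub>F t in at_right 0. dist (norm (G (X t)) / t) \<kappa> < r"
    proof eventually_elim
      case (elim t)
      have "\<bar>norm (G (X t)) - norm (T (t *\<^sub>R u))\<bar> \<le> norm (G (X t) - T (t *\<^sub>R u))"
        by (rule norm_triangle_ineq3)
      also have "\<dots> \<le> r/2 * t" using elim nu by (simp add: X_def)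
      finally have "\<bar>norm (G (X t)) - t * \<kappa>\<bar> \<le> r/2 * t"
        using elim(2) nu ev by (simp add: linear_scale[OF lin] Tu)
      hence "\<bar>norm (G (X t)) - t * \<kappa>\<bar> / t \<le> r/2" using elim(2) by (simp add: field_simps)
      moreover have "\<bar>norm (G (X t)) / t - \<kappa>\<bar> = \<bar>norm (G (X t)) - t * \<kappa>\<bar> / t"
        using elim(2) by (simp add: diff_divide_distrib[symmetric] abs_divide[symmetric] field_simps)
      ultimately show ?case using r unfolding dist_real_def by linarith
    qed
  qed
  have limF: "((\<lambda>t. (f (X t) - f xb) / t\<^sup>2) \<longlongrightarrow> \<kappa> / 2) (at_right 0)"
  proof (rule tendstoI)
    fix r :: real assume r: "0 < r"
    have "\<forall>\<^sub>F x in nhds xb. \<bar>f x - f xb - ((x - xb) \<bullet> T (x - xb)) / 2\<bar> \<le> (r/2) * (norm (x - xb))\<^sup>2"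
      using critical_point_taylor2[OF grad der crit, of "r/2"] r by simp
    from eventually_compose_filterlim[OF this X] tpos
    show "\<forall>\<^sub>F t in at_right 0. dist ((f (X t) - f xb) / t\<^sup>2) (\<kappa>/2) < r"
    proof eventually_elim
      case (elim t)
      have "\<bar>f (X t) - f xb - t\<^sup>2 * \<kappa> / 2\<bar> \<le> r/2 * t\<^sup>2"
        using elim nu uTu by (simp add: X_def linear_scale[OF lin] power2_eq_square mult.assoc)
      hence "\<bar>f (X t) - f xb - t\<^sup>2 * \<kappa> / 2\<bar> / t\<^sup>2 \<le> r/2" using elim(2) by (simp add: field_simps)
      moreover have "\<bar>(f (X t) - f xb) / t\<^sup>2 - \<kappa> / 2\<bar> = \<bar>f (X t) - f xb - t\<^sup>2 * \<kappa> / 2\<bar> / t\<^sup>2"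
      proof -
        have "(f (X t) - f xb) / t\<^sup>2 - \<kappa> / 2 = (f (X t) - f xb - t\<^sup>2 * \<kappa> / 2) / t\<^sup>2"
          using elim(2) by (simp add: field_simps)
        thus ?thesis by (simp add: abs_divide)
      qed
      ultimately show ?case using r unfolding dist_real_def by linarith
    qed
  qed
  have "\<forall>\<^sub>F t in at_right 0. 0 < (f (X t) - f xb) / t\<^sup>2"
    using order_tendstoD(1)[OF limF, of 0] ev(3) by simp
  hence fpos: "\<forall>\<^sub>F t in at_right 0. f xb < f (X t)"
    using tpos by eventually_elim (simp add: zero_less_divide_iff)
  have \<sigma>: "0 < \<sigma>" and "\<forall>\<^sub>F x in nhds xb. f xb < f x \<longrightarrow>
     ereal (\<sigma> / (1 - \<theta>) * (f x - f xb) powr \<theta>) \<le> edist_set 0 (limiting_subdiff f x)"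
    using KL KL_with_modulus_iff_eventually[OF cont] by blast+
  from eventually_compose_filterlim[OF this(2) X] eventually_compose_filterlim[OF dist X] fpos tpos
  have ineq: "\<forall>\<^sub>F t in at_right 0. \<sigma> / (1 - \<theta>) * ((f (X t) - f xb) / t\<^sup>2) powr \<theta>
      \<le> norm (G (X t)) / t * t powr (1 - 2 * \<theta>)"
  proof eventually_elim
    case (elim t)
    have t2: "t\<^sup>2 powr \<theta> = t powr (2 * \<theta>)"
      using elim(4) powr_powr[of t 2 \<theta>] by simp
    have "\<sigma> / (1 - \<theta>) * (f (X t) - f xb) powr \<theta> \<le> norm (G (X t))" using elim by simp
    hence "\<sigma> / (1 - \<theta>) * (f (X t) - f xb) powr \<theta> / t powr (2*\<theta>) \<le> norm (G (X t)) / t powr (2*\<theta>)"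
      by (intro divide_right_mono) auto
    thus ?case using elim(3,4) by (simp add: powr_divide t2 powr_diff)
  qed
  have lhs: "((\<lambda>t. \<sigma> / (1 - \<theta>) * ((f (X t) - f xb) / t\<^sup>2) powr \<theta>) \<longlongrightarrow> \<sigma> / (1 - \<theta>) * (\<kappa>/2) powr \<theta>) (at_right 0)"
    using ev(3) by (intro tendsto_intros limF) auto
  show ?thesis
  proof (cases "\<theta> = 1/2")
    case True
    have "((\<lambda>t. norm (G (X t)) / t * t powr (1 - 2 * \<theta>)) \<longlongrightarrow> \<kappa>) (at_right 0)"
      by (rule Lim_transform_eventually[OF limG]) (rule eventually_mono[OF tpos], simp add: True)
    from tendsto_le[OF trivial_limit_at_right_real this lhs ineq] have "\<sigma> / (1 - \<theta>) * (\<kappa>/2) powr \<theta> \<le> \<kappa>" .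
    hence "2 * (\<sigma> * sqrt (\<kappa>/2)) \<le> \<kappa>"
      using ev(3) True by (simp add: powr_half_sqrt mult.commute)
    moreover have "\<kappa> = 2 * (sqrt (\<kappa>/2) * sqrt (\<kappa>/2))" using ev(3) by simp
    ultimately have "\<sigma> * sqrt (\<kappa>/2) \<le> sqrt (\<kappa>/2) * sqrt (\<kappa>/2)" by linarith
    hence "\<sigma> \<le> sqrt (\<kappa>/2)" by (rule mult_right_le_imp_le) (use ev(3) in simp)
    with True show ?thesis by blast
  next
    case False
    hence pos: "1 - 2 * \<theta> > 0" using th by simp
    have "\<forall>\<^sub>F t in at_right 0. (0::real) \<le> t" using tpos by (rule eventually_mono) simp
    hence "((\<lambda>t. t powr (1 - 2 * \<theta>)) \<longlongrightarrow> 0 powr (1 - 2 * \<theta>)) (at_right 0)"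
      using pos by (intro tendsto_powr'[OF tendsto_ident_at tendsto_const]) simp
    from tendsto_mult[OF limG this]
    have "((\<lambda>t. norm (G (X t)) / t * t powr (1 - 2 * \<theta>)) \<longlongrightarrow> 0) (at_right 0)"
      by simp
    from tendsto_le[OF trivial_limit_at_right_real this lhs ineq] have "\<sigma> / (1 - \<theta>) * (\<kappa>/2) powr \<theta> \<le> 0" .
    moreover have "\<sigma> / (1 - \<theta>) * (\<kappa>/2) powr \<theta> > 0" using \<sigma> th ev(3) by simp
    ultimately show ?thesis by simp
  qed
qed

lemma Sup_open_initial_moduli:
  assumes "0 < s" and low: "\<And>\<sigma>. 0 < \<sigma> \<Longrightarrow> \<sigma> < s \<Longrightarrow> P \<sigma>" and up: "\<And>\<sigma>. P \<sigma> \<Longrightarrow> \<sigma> \<le> s"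
  shows "Sup (insert 0 (ereal ` {\<sigma>. P \<sigma>})) = ereal s"
proof (rule Sup_eqI)
  fix y assume "y \<in> insert 0 (ereal ` {\<sigma>. P \<sigma>})"
  thus "y \<le> ereal s" using up assms(1) by auto
next
  fix y assume ub: "\<And>z. z \<in> insert 0 (ereal ` {\<sigma>. P \<sigma>}) \<Longrightarrow> z \<le> y"
  show "ereal s \<le> y"
  proof (rule dense_le)
    fix z assume z: "z < ereal s"
    show "z \<le> y"
    proof (cases z)
      case (real r)
      show ?thesis
      proof (cases "0 < r")
        case True
        thus ?thesis using ub[of z] low[of r] z real by auto
      next
        case False
        hence "z \<le> 0" using real by simp
        also have "0 \<le> y" using ub by simp
        finally show ?thesis .
      qed
    qed (use z in auto)
  qed
qed

section \<open>Powers of the absolute value\<close>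

lemma abs_powr_has_real_derivative:
  fixes t q :: real
  assumes "t \<noteq> 0"
  shows "((\<lambda>t. \<bar>t\<bar> powr q) has_real_derivative q * (sgn t * \<bar>t\<bar> powr (q - 1))) (at t)"
proof (cases "t > 0")
  case True
  have "((\<lambda>t. t powr q) has_real_derivative q * (sgn t * \<bar>t\<bar> powr (q - 1))) (at t)"
    using has_real_derivative_powr[OF True, of q] True by simp
  thus ?thesis
    by (rule has_field_derivative_transform_within_open[of _ _ _ "{0<..}"]) (use True in auto)
next
  case False
  hence t: "0 < - t" using assms by simp
  have "((\<lambda>t. (- t) powr q) has_real_derivative (q * (- t) powr (q - 1)) * - 1) (at t)"
    by (rule DERIV_chain2[where g = uminus, OF has_real_derivative_powr[OF t]])
      (auto intro!: derivative_eq_intros)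
  hence "((\<lambda>t. (- t) powr q) has_real_derivative q * (sgn t * \<bar>t\<bar> powr (q - 1))) (at t)"
    using t by (simp add: abs_if)
  thus ?thesis
    by (rule has_field_derivative_transform_within_open[of _ _ _ "{..<0}"]) (use t in auto)
qed

lemma sgn_abs_powr_has_real_derivative:
  fixes t q :: real
  assumes "t \<noteq> 0"
  shows "((\<lambda>t. sgn t * \<bar>t\<bar> powr q) has_real_derivative q * \<bar>t\<bar> powr (q - 1)) (at t)"
proof -
  have "((\<lambda>s. sgn t * \<bar>s\<bar> powr q) has_real_derivative sgn t * (q * (sgn t * \<bar>t\<bar> powr (q - 1)))) (at t)"
    by (intro DERIV_cmult abs_powr_has_real_derivative assms)
  moreover have "sgn t * (q * (sgn t * \<bar>t\<bar> powr (q - 1))) = q * \<bar>t\<bar> powr (q - 1)"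
    using assms by (simp add: sgn_if)
  ultimately have D: "((\<lambda>s. sgn t * \<bar>s\<bar> powr q) has_real_derivative q * \<bar>t\<bar> powr (q - 1)) (at t)"
    by simp
  show ?thesis
  proof (cases "t > 0")
    case True
    show ?thesis
      by (rule has_field_derivative_transform_within_open[OF D, of "{0<..}"]) (use True in auto)
  next
    case False
    show ?thesis
      by (rule has_field_derivative_transform_within_open[OF D, of "{..<0}"]) (use False assms in auto)
  qed
qed

text \<open>The cusp of \<open>\<bar>t\<bar> powr p\<close> at \<open>0\<close> lies above every line: the source of the arbitrary entries of
  subgradients off the support.\<close>
lemma linear_le_abs_powr_near_0:
  fixes c \<mu> p :: real
  assumes "p < 1" and "0 < \<mu>"
  shows "\<forall>\<^sub>F t in nhds 0. c * t \<le> \<mu> * \<bar>t\<bar> powr p"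
proof -
  have "((\<lambda>t::real. \<bar>c\<bar> * \<bar>t\<bar> powr (1 - p)) \<longlongrightarrow> \<bar>c\<bar> * \<bar>0\<bar> powr (1 - p)) (nhds 0)"
    using assms by (intro tendsto_mult tendsto_const tendsto_powr' tendsto_rabs) (auto simp: filterlim_ident)
  hence "\<forall>\<^sub>F t in nhds 0. \<bar>c\<bar> * \<bar>t\<bar> powr (1 - p) < \<mu>"
    using assms by (intro order_tendstoD(2)) auto
  thus ?thesis
  proof eventually_elim
    case (elim t)
    show ?case
    proof (cases "t = 0")
      case False
      have "c * t \<le> \<bar>c\<bar> * \<bar>t\<bar>" by (metis abs_ge_self abs_mult)
      also have "\<bar>t\<bar> = \<bar>t\<bar> powr (1 - p) * \<bar>t\<bar> powr p"
        using False by (simp add: powr_add[symmetric])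
      also have "\<bar>c\<bar> * (\<bar>t\<bar> powr (1 - p) * \<bar>t\<bar> powr p) \<le> \<mu> * \<bar>t\<bar> powr p"
        using elim by (simp add: mult.assoc[symmetric] mult_right_mono)
      finally show ?thesis .
    qed simp
  qed
qed

lemma abs_powr_neg_blowup:
  fixes p K :: real
  assumes "p < 1"
  shows "\<forall>\<^sub>F t in nhds 0. t \<noteq> 0 \<longrightarrow> K \<le> \<bar>t\<bar> powr (p - 1)"
proof (cases "K > 0")
  case True
  define \<delta> where "\<delta> = K powr (1 / (p - 1))"
  have d: "\<delta> > 0" using True by (simp add: \<delta>_def)
  have K: "\<delta> powr (p - 1) = K" using True assms by (simp add: \<delta>_def powr_powr)
  have "\<forall>\<^sub>F t in nhds 0. dist t 0 < \<delta>" using d unfolding eventually_nhds_metric by blast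
  thus ?thesis
  proof eventually_elim
    case (elim t)
    show ?case
    proof
      assume "t \<noteq> 0"
      thus "K \<le> \<bar>t\<bar> powr (p - 1)"
        using powr_mono2'[of "p - 1" "\<bar>t\<bar>" \<delta>] elim assms K by simp
    qed
  qed
next
  case False
  have "K \<le> \<bar>t\<bar> powr (p - 1)" for t :: real using False powr_ge_zero[of "\<bar>t\<bar>" "p - 1"] by linarith
  thus ?thesis by simp
qed

section \<open>Subgradients of the regularized least squares objective\<close>

text \<open>At a zero entry the power term contributes \<open>0\<close>, since \<open>sgn 0 = 0\<close>. So at every point this is the
  gradient of \<open>support_objective\<close> below for the support of that point.\<close>
definition formal_grad :: "real^'n^'m \<Rightarrow> real^'m \<Rightarrow> real \<Rightarrow> real \<Rightarrow> real^'n \<Rightarrow> real^'n" where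
  "formal_grad A b \<mu> p x =
     2 *\<^sub>R (transpose A *v (A *v x - b)) + \<mu> *\<^sub>R (\<chi> i. p * (sgn (x $ i) * \<bar>x $ i\<bar> powr (p - 1)))"

text \<open>The subgradient of least norm, see \<open>min_subgrad_least_norm\<close>.\<close>
definition min_subgrad :: "real^'n^'m \<Rightarrow> real^'m \<Rightarrow> real \<Rightarrow> real \<Rightarrow> real^'n \<Rightarrow> real^'n" where
  "min_subgrad A b \<mu> p x = (\<chi> i. if x $ i = 0 then 0 else formal_grad A b \<mu> p x $ i)"

text \<open>The objective with the power terms off \<open>S\<close> dropped; for \<open>S = supp x\<close> it is the part that is
  smooth at \<open>x\<close>.\<close>
definition support_objective ::
    "real^'n^'m \<Rightarrow> real^'m \<Rightarrow> real \<Rightarrow> real \<Rightarrow> 'n set \<Rightarrow> real^'n \<Rightarrow> real" where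
  "support_objective A b \<mu> p S x = (norm (A *v x - b))\<^sup>2 + \<mu> * (\<Sum>i\<in>S. \<bar>x $ i\<bar> powr p)"

lemma lp_least_squares_split:
  "lp_least_squares A b \<mu> p x =
     support_objective A b \<mu> p S x + \<mu> * (\<Sum>i\<in>-S. \<bar>x $ i\<bar> powr p)"
proof -
  have "lp_pow p x = (\<Sum>i\<in>S. \<bar>x $ i\<bar> powr p) + (\<Sum>i\<in>-S. \<bar>x $ i\<bar> powr p)"
    unfolding lp_pow_def Compl_eq_Diff_UNIV
    by (subst sum.subset_diff[of S]) auto
  thus ?thesis
    by (simp add: lp_least_squares_def support_objective_def algebra_simps)
qed

lemma inner_transpose_mult: "h \<bullet> (transpose A *v w) = (A *v h) \<bullet> (w :: real^'m)"
  for A :: "real^'n^'m"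
  by (metis dot_lmul_matrix inner_commute transpose_matrix_vector)

lemma support_objective_gderiv:
  assumes "S = supp x"
  shows "GDERIV (support_objective A b \<mu> p S) x :> formal_grad A b \<mu> p x"
proof -
  let ?g = "\<lambda>i. p * (sgn (x $ i) * \<bar>x $ i\<bar> powr (p - 1))"
  have nth: "((\<lambda>y. y $ i) has_derivative (\<lambda>h. h $ i)) (at x)" for i
    by (rule bounded_linear_imp_has_derivative[OF bounded_linear_vec_nth])
  have A: "((\<lambda>y. A *v y - b) has_derivative (\<lambda>h. A *v h)) (at x)"
    using bounded_linear_imp_has_derivative[OF matrix_vector_mul_bounded_linear[of A]]
    by (auto intro!: derivative_eq_intros)
  have quad: "((\<lambda>y. (norm (A *v y - b))\<^sup>2) has_derivative (\<lambda>h. 2 * ((A *v h) \<bullet> (A *v x - b)))) (at x)"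
    unfolding power2_norm_eq_inner
    using has_derivative_inner[OF A A] by (simp add: inner_commute mult_2[symmetric])
  have pow: "((\<lambda>y. \<bar>y $ i\<bar> powr p) has_derivative (\<lambda>h. h $ i * ?g i)) (at x)" if "i \<in> S" for i
  proof -
    have "x $ i \<noteq> 0" using that assms by (simp add: supp_def)
    from has_derivative_compose[OF nth this[THEN abs_powr_has_real_derivative,
        unfolded has_field_derivative_def]]
    show ?thesis by (simp add: mult.commute)
  qed
  have "((\<lambda>y. (norm (A *v y - b))\<^sup>2 + \<mu> * (\<Sum>i\<in>S. \<bar>y $ i\<bar> powr p)) has_derivative
      (\<lambda>h. 2 * ((A *v h) \<bullet> (A *v x - b)) + \<mu> * (\<Sum>i\<in>S. h $ i * ?g i))) (at x)"
    by (intro has_derivative_add quad has_derivative_mult_right has_derivative_sum pow)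
  moreover have "2 * ((A *v h) \<bullet> (A *v x - b)) + \<mu> * (\<Sum>i\<in>S. h $ i * ?g i)
      = h \<bullet> formal_grad A b \<mu> p x" for h
  proof -
    have "(\<Sum>i\<in>S. h $ i * ?g i) = (\<Sum>i\<in>UNIV. h $ i * ?g i)"
      by (rule sum.mono_neutral_left) (auto simp: assms supp_def)
    also have "\<dots> = h \<bullet> (\<chi> i. ?g i)" by (simp add: inner_vec_def)
    finally show ?thesis
      unfolding formal_grad_def inner_add_right inner_scaleR_right inner_transpose_mult by simp
  qed
  ultimately show ?thesis
    unfolding gderiv_def support_objective_def by simp
qed

lemma support_objective_remainder:
  assumes "S = supp x"
  shows "(\<lambda>y. support_objective A b \<mu> p S y - support_objective A b \<mu> p S x
            - (y - x) \<bullet> formal_grad A b \<mu> p x) \<in> o[at x](\<lambda>y. norm (y - x))"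
proof (rule landau_o.smallI)
  fix c :: real assume c: "c > 0"
  show "\<forall>\<^sub>F y in at x. norm (support_objective A b \<mu> p S y - support_objective A b \<mu> p S x
            - (y - x) \<bullet> formal_grad A b \<mu> p x) \<le> c * norm (norm (y - x))"
    using support_objective_gderiv[OF assms, of A b \<mu> p] c
    unfolding gderiv_def has_derivative_at_alt eventually_at dist_norm
      real_norm_def abs_norm_cancel by blast
qed

text \<open>Along the coordinate axis \<open>i\<close> through \<open>x\<close> the objective is differentiable at \<open>x\<close>, so the \<open>i\<close>-th entry
  of a subgradient is forced to be the partial derivative.\<close>
lemma regular_subdiff_support_eq:
  assumes v: "v \<in> regular_subdiff (lp_least_squares A b \<mu> p) x" and i: "x $ i \<noteq> 0"
  shows "v $ i = formal_grad A b \<mu> p x $ i"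
proof (rule ccontr)
  assume ne: "v $ i \<noteq> formal_grad A b \<mu> p x $ i"
  define k where "k = formal_grad A b \<mu> p x $ i - v $ i"
  have k: "\<bar>k\<bar> > 0" using ne by (simp add: k_def)
  define f where "f = support_objective A b \<mu> p (supp x)"
  define R where "R = (\<lambda>y. f y - f x - (y - x) \<bullet> formal_grad A b \<mu> p x)"
  obtain r where r: "r \<in> o[at x](\<lambda>y. norm (y - x))" and
    low: "\<And>y. lp_least_squares A b \<mu> p y \<ge> lp_least_squares A b \<mu> p x + v \<bullet> (y - x) + r y"
    using v unfolding regular_subdiff_def by blast
  have "R \<in> o[at x](\<lambda>y. norm (y - x))"
    unfolding R_def f_def by (rule support_objective_remainder) simp
  from landau_o.smallD[OF this, of "\<bar>k\<bar>/4"] landau_o.smallD[OF r, of "\<bar>k\<bar>/4"]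
  have "\<forall>\<^sub>F y in at x. \<bar>R y\<bar> \<le> \<bar>k\<bar>/4 * norm (y - x) \<and> \<bar>r y\<bar> \<le> \<bar>k\<bar>/4 * norm (y - x)"
    using k by (auto elim: eventually_elim2)
  then obtain \<delta> where d: "\<delta> > 0" and
    D: "\<And>y. y \<noteq> x \<Longrightarrow> norm (y - x) < \<delta> \<Longrightarrow> \<bar>R y\<bar> \<le> \<bar>k\<bar>/4 * norm (y - x) \<and> \<bar>r y\<bar> \<le> \<bar>k\<bar>/4 * norm (y - x)"
    unfolding eventually_at dist_norm by blast
  \<comment> \<open>move along the axis to the side where the objective falls below its linear bound by \<open>v\<close>\<close>
  define t where "t = - sgn k * (\<delta>/2)"
  have t: "\<bar>t\<bar> = \<delta>/2" and tk: "t * k = - (\<delta>/2 * \<bar>k\<bar>)"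
    using k d by (auto simp: t_def abs_mult sgn_if)
  define y where "y = x + t *\<^sub>R axis i 1"
  have ny: "norm (y - x) = \<delta>/2" using t by (simp add: y_def)
  have split: "lp_least_squares A b \<mu> p z = f z" if "\<And>j. x $ j = 0 \<Longrightarrow> z $ j = 0" for z
  proof -
    have "(\<Sum>j\<in>-supp x. \<bar>z $ j\<bar> powr p) = 0"
      using that by (intro sum.neutral) (auto simp: supp_def)
    thus ?thesis unfolding f_def by (subst lp_least_squares_split[of _ _ _ _ _ "supp x"]) simp
  qed
  have Fx: "lp_least_squares A b \<mu> p x = f x" by (rule split)
  have Fy: "lp_least_squares A b \<mu> p y = f y" by (rule split) (use i in \<open>auto simp: y_def axis_def\<close>)
  have "R y + t * k = f y - f x - v \<bullet> (y - x)"
    by (simp add: R_def y_def k_def inner_axis inner_axis' algebra_simps)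
  also have "\<dots> \<ge> r y" using low[of y] Fx Fy by simp
  finally have "r y - R y \<le> - (\<delta>/2 * \<bar>k\<bar>)" using tk by simp
  moreover have "\<bar>R y\<bar> \<le> \<bar>k\<bar>/4 * (\<delta>/2)" "\<bar>r y\<bar> \<le> \<bar>k\<bar>/4 * (\<delta>/2)"
    using D[of y] d ny by auto
  moreover have "0 < \<delta>/2 * \<bar>k\<bar>" using d k by simp
  moreover have "\<bar>k\<bar>/4 * (\<delta>/2) = \<delta>/2 * \<bar>k\<bar> / 4" by simp
  ultimately show False by linarith
qed

text \<open>Off the support the cusps dominate the linear terms, so only the differentiability
  remainder \<open>R\<close> of the smooth part can make the first-order estimate fail.\<close>
lemma regular_subdiff_supportI:
  assumes "p < 1" and "0 < \<mu>" and v: "\<And>i. x $ i \<noteq> 0 \<Longrightarrow> v $ i = formal_grad A b \<mu> p x $ i"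
  shows "v \<in> regular_subdiff (lp_least_squares A b \<mu> p) x"
proof -
  let ?F = "lp_least_squares A b \<mu> p" and ?w = "formal_grad A b \<mu> p x"
  define f where "f = support_objective A b \<mu> p (supp x)"
  define R where "R = (\<lambda>y. f y - f x - (y - x) \<bullet> ?w)"
  \<comment> \<open>the largest nonpositive remainder for which the subgradient inequality holds everywhere\<close>
  define r where "r = (\<lambda>y. min 0 (?F y - ?F x - v \<bullet> (y - x)))"
  have R: "R \<in> o[at x](\<lambda>y. norm (y - x))"
    unfolding R_def f_def by (rule support_objective_remainder) simp
  have "\<forall>\<^sub>F y in nhds x. \<forall>i. x $ i = 0 \<longrightarrow> (v $ i - ?w $ i) * y $ i \<le> \<mu> * \<bar>y $ i\<bar> powr p"
  proof (rule eventually_all_finite)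
    fix i
    show "\<forall>\<^sub>F y in nhds x. x $ i = 0 \<longrightarrow> (v $ i - ?w $ i) * y $ i \<le> \<mu> * \<bar>y $ i\<bar> powr p"
    proof (cases "x $ i = 0")
      case True
      have "((\<lambda>y. y $ i) \<longlongrightarrow> x $ i) (nhds x)" by (intro tendsto_intros filterlim_ident)
      hence "filterlim (\<lambda>y. y $ i) (nhds 0) (nhds x)" using True by simp
      from eventually_compose_filterlim[OF linear_le_abs_powr_near_0[OF assms(1,2)] this]
      show ?thesis by simp
    qed simp
  qed
  hence "\<forall>\<^sub>F y in at x. \<bar>r y\<bar> \<le> \<bar>R y\<bar>"
    unfolding eventually_at_filter
  proof eventually_elim
    case (elim y)
    have Fx: "?F x = f x"
    proof -
      have "(\<Sum>j\<in>-supp x. \<bar>x $ j\<bar> powr p) = 0" by (intro sum.neutral) (auto simp: supp_def)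
      thus ?thesis unfolding f_def by (subst lp_least_squares_split[of _ _ _ _ _ "supp x"]) simp
    qed
    have "(v - ?w) \<bullet> (y - x) = (\<Sum>i\<in>UNIV. (v $ i - ?w $ i) * (y $ i - x $ i))"
      by (simp add: inner_vec_def)
    also have "\<dots> = (\<Sum>i\<in>-supp x. (v $ i - ?w $ i) * (y $ i - x $ i))"
      by (rule sum.mono_neutral_right) (auto simp: supp_def v)
    also have "\<dots> \<le> (\<Sum>i\<in>-supp x. \<mu> * \<bar>y $ i\<bar> powr p)"
      using elim by (intro sum_mono) (auto simp: supp_def)
    also have "\<dots> = ?F y - f y"
      unfolding f_def by (subst lp_least_squares_split[of _ _ _ _ _ "supp x"]) (simp add: sum_distrib_left)
    finally have "R y \<le> ?F y - ?F x - v \<bullet> (y - x)"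
      unfolding R_def Fx inner_diff_left[of v] inner_commute[of "y - x"] by linarith
    thus ?case by (auto simp: r_def)
  qed
  hence "r \<in> o[at x](\<lambda>y. norm (y - x))"
    using R by (intro landau_o.big_small_trans[of r _ R] landau_o.bigI[of 1]) auto
  moreover have "?F y \<ge> ?F x + v \<bullet> (y - x) + r y" for y by (simp add: r_def)
  ultimately show ?thesis unfolding regular_subdiff_def by blast
qed

lemma isCont_formal_grad_nth:
  assumes "x $ i \<noteq> 0"
  shows "isCont (\<lambda>x. formal_grad A b \<mu> p x $ i) x"
proof -
  have "isCont (\<lambda>y. y $ i) x" by (intro continuous_intros)
  moreover have "isCont (\<lambda>t. sgn t * \<bar>t\<bar> powr (p - 1)) (x $ i)"
    using sgn_abs_powr_has_real_derivative[OF assms] DERIV_isCont by blast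
  ultimately have s: "isCont (\<lambda>y. sgn (y $ i) * \<bar>y $ i\<bar> powr (p - 1)) x" by (rule isCont_o2)
  have A: "isCont (\<lambda>y. (transpose A *v (A *v y - b)) $ i) x"
    by (intro continuous_intros linear_continuous_at
        bounded_linear.continuous[OF matrix_vector_mul_bounded_linear])
  show ?thesis
    unfolding formal_grad_def vector_add_component vector_scaleR_component vec_lambda_beta
    by (intro continuous_add continuous_mult continuous_scaleR continuous_const s A)
qed

text \<open>Supports can only grow under small perturbations, and the partial derivatives on the
  support are continuous; so limits of regular subgradients satisfy the same equations.\<close>
lemma limiting_subdiff_lp_least_squares:
  assumes "p < 1" and "0 < \<mu>"
  shows "limiting_subdiff (lp_least_squares A b \<mu> p) x =
    {v. \<forall>i. x $ i \<noteq> 0 \<longrightarrow> v $ i = formal_grad A b \<mu> p x $ i}" (is "?L = ?R")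
proof
  show "?R \<subseteq> ?L"
  proof
    fix v assume "v \<in> ?R"
    hence "v \<in> regular_subdiff (lp_least_squares A b \<mu> p) x"
      using regular_subdiff_supportI[OF assms] by blast
    thus "v \<in> ?L" unfolding limiting_subdiff_def mem_Collect_eq
      by (intro exI[of _ "\<lambda>_. x"] exI[of _ "\<lambda>_. v"]) simp
  qed
  show "?L \<subseteq> ?R"
  proof (intro subsetI CollectI allI impI)
    fix v i assume "v \<in> ?L" and i: "x $ i \<noteq> 0"
    then obtain X V where X: "X \<longlonglongrightarrow> x" and V: "V \<longlonglongrightarrow> v" and
      reg: "\<And>k. V k \<in> regular_subdiff (lp_least_squares A b \<mu> p) (X k)"
      unfolding limiting_subdiff_def by blast
    have "(\<lambda>k. X k $ i) \<longlonglongrightarrow> x $ i" using X by (rule tendsto_vec_nth)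
    hence "\<forall>\<^sub>F k in sequentially. X k $ i \<noteq> 0" using i by (rule tendsto_imp_eventually_ne)
    hence "\<forall>\<^sub>F k in sequentially. formal_grad A b \<mu> p (X k) $ i = V k $ i"
      by eventually_elim (simp add: regular_subdiff_support_eq[OF reg])
    moreover have "(\<lambda>k. formal_grad A b \<mu> p (X k) $ i) \<longlonglongrightarrow> formal_grad A b \<mu> p x $ i"
      using isCont_formal_grad_nth[OF i] X by (rule isCont_tendsto_compose)
    ultimately have "(\<lambda>k. V k $ i) \<longlonglongrightarrow> formal_grad A b \<mu> p x $ i"
      by (rule Lim_transform_eventually[rotated])
    thus "v $ i = formal_grad A b \<mu> p x $ i"
      using tendsto_vec_nth[OF V] LIMSEQ_unique by blast
  qed
qed

lemma min_subgrad_least_norm: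
  assumes "p < 1" and "0 < \<mu>" and "v \<in> limiting_subdiff (lp_least_squares A b \<mu> p) x"
  shows "norm (min_subgrad A b \<mu> p x) \<le> norm v"
  using assms(3) unfolding limiting_subdiff_lp_least_squares[OF assms(1,2)]
  by (intro norm_le_componentwise_cart) (simp add: min_subgrad_def)

lemma edist_limiting_subdiff_lp_least_squares:
  assumes "p < 1" and "0 < \<mu>"
  shows "edist_set 0 (limiting_subdiff (lp_least_squares A b \<mu> p) x) = ereal (norm (min_subgrad A b \<mu> p x))"
proof -
  have "min_subgrad A b \<mu> p x \<in> limiting_subdiff (lp_least_squares A b \<mu> p) x"
    unfolding limiting_subdiff_lp_least_squares[OF assms] by (simp add: min_subgrad_def)
  thus ?thesis unfolding edist_set_def
    by (intro antisym INF_lower2 INF_greatest) (auto intro: min_subgrad_least_norm[OF assms])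
qed

lemma isCont_lp_least_squares:
  assumes "0 < p"
  shows "isCont (lp_least_squares A b \<mu> p) x"
proof -
  have pow: "isCont (\<lambda>y. \<bar>y $ i\<bar> powr p) x" for i
    using assms unfolding isCont_def by (intro tendsto_powr' tendsto_intros) auto
  have "isCont (\<lambda>y. A *v y) x"
    by (intro linear_continuous_at matrix_vector_mul_bounded_linear)
  hence "isCont (\<lambda>y. (norm (A *v y - b))\<^sup>2 + \<mu> * (\<Sum>i\<in>UNIV. \<bar>y $ i\<bar> powr p)) x"
    by (intro continuous_add continuous_mult continuous_power continuous_norm continuous_diff
        continuous_const continuous_sum pow)
  thus ?thesis by (simp add: lp_least_squares_def[abs_def] lp_pow_def)
qed

section \<open>Reduction to the support\<close>

text \<open>The right inverse of \<open>subvector e\<close> that identifies the vectors indexed by the support with the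
  coordinate subspace of vectors supported there.\<close>
definition zero_extend :: "('k \<Rightarrow> 'n) \<Rightarrow> real^'k \<Rightarrow> real^'n" where
  "zero_extend e y = (\<chi> i. if i \<in> range e then y $ inv e i else 0)"

lemma zero_extend_nth:
  "inj e \<Longrightarrow> zero_extend e y $ e j = y $ j" "i \<notin> range e \<Longrightarrow> zero_extend e y $ i = 0"
  by (simp_all add: zero_extend_def)

lemma zero_extend_subvector:
  assumes "inj e" and "supp x \<subseteq> range e"
  shows "zero_extend e (subvector e x) = x"
proof (rule vec_eq_iff[THEN iffD2], rule allI)
  fix i
  show "zero_extend e (subvector e x) $ i = x $ i"
  proof (cases "i \<in> range e")
    case True
    then obtain j where "i = e j" by blast
    then show ?thesis using assms(1) by (simp add: zero_extend_nth subvector_def)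
  next
    case False
    then have "x $ i = 0" using assms(2) by (auto simp: supp_def)
    then show ?thesis using False by (simp add: zero_extend_nth)
  qed
qed

lemma sum_supported_on_range:
  fixes e :: "'k::finite \<Rightarrow> 'n::finite"
  assumes "inj e" and "\<And>i. i \<notin> range e \<Longrightarrow> g i = 0"
  shows "(\<Sum>i\<in>UNIV. g i) = (\<Sum>j\<in>UNIV. g (e j))"
proof -
  have "(\<Sum>i\<in>UNIV. g i) = (\<Sum>i\<in>range e. g i)"
    by (rule sum.mono_neutral_right) (auto simp: assms)
  also have "\<dots> = (\<Sum>j\<in>UNIV. g (e j))" by (simp add: sum.reindex assms(1))
  finally show ?thesis .
qed

context
  fixes e :: "'k::finite \<Rightarrow> 'n::finite"
  assumes e: "inj e"
begin

lemma norm_zero_extend: "norm (zero_extend e y) = norm y"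
proof -
  have "zero_extend e y \<bullet> zero_extend e y = y \<bullet> y"
    unfolding inner_vec_def by (subst sum_supported_on_range[OF e]) (simp_all add: zero_extend_nth e)
  thus ?thesis by (simp add: norm_eq_sqrt_inner)
qed

lemma linear_zero_extend: "linear (zero_extend e)"
  by (intro linearI) (simp_all add: zero_extend_def vec_eq_iff)

lemma mult_zero_extend: "A *v zero_extend e y = column_submatrix e A *v y"
  by (simp add: matrix_vector_mult_def vec_eq_iff column_submatrix_def
      sum_supported_on_range[OF e] zero_extend_nth e)

lemma lp_pow_zero_extend: "lp_pow p (zero_extend e y) = lp_pow p y"
  unfolding lp_pow_def by (subst sum_supported_on_range[OF e]) (simp_all add: zero_extend_nth e)

lemma lp_least_squares_zero_extend:
  "lp_least_squares A b \<mu> p (zero_extend e y) = lp_least_squares (column_submatrix e A) b \<mu> p y"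
  by (simp add: lp_least_squares_def mult_zero_extend lp_pow_zero_extend)

lemma formal_grad_zero_extend_nth:
  "formal_grad A b \<mu> p (zero_extend e y) $ e j = formal_grad (column_submatrix e A) b \<mu> p y $ j"
proof -
  have "(transpose A *v w) $ e j = (transpose (column_submatrix e A) *v w) $ j" for w
    by (simp add: matrix_vector_mult_def transpose_def column_submatrix_def del: transpose_matrix_vector)
  thus ?thesis
    by (simp add: formal_grad_def zero_extend_nth e mult_zero_extend del: transpose_matrix_vector)
qed

lemma norm_min_subgrad_zero_extend:
  "norm (min_subgrad A b \<mu> p (zero_extend e y)) = norm (min_subgrad (column_submatrix e A) b \<mu> p y)"
proof -
  have "min_subgrad A b \<mu> p (zero_extend e y) = zero_extend e (min_subgrad (column_submatrix e A) b \<mu> p y)"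
  proof (rule vec_eq_iff[THEN iffD2], rule allI)
    fix i
    show "min_subgrad A b \<mu> p (zero_extend e y) $ i
        = zero_extend e (min_subgrad (column_submatrix e A) b \<mu> p y) $ i"
      by (cases "i \<in> range e") (auto simp: min_subgrad_def zero_extend_nth e formal_grad_zero_extend_nth)
  qed
  thus ?thesis by (simp add: norm_zero_extend)
qed

end

lemma isCont_tendsto_nhds: "isCont f x \<Longrightarrow> (f \<longlongrightarrow> f x) (nhds x)"
  by (simp add: isCont_def tendsto_at_iff_tendsto_nhds)

lemma eventually_nonzero_on_supp: "\<forall>\<^sub>F x in nhds xb. \<forall>i. xb $ i \<noteq> 0 \<longrightarrow> x $ i \<noteq> 0"
  for xb :: "real^'n"
proof (rule eventually_all_finite)
  fix i
  have "((\<lambda>y. y $ i) \<longlongrightarrow> xb $ i) (nhds xb)" by (intro tendsto_intros filterlim_ident)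
  from tendsto_imp_eventually_ne[OF this, of 0]
  show "\<forall>\<^sub>F x in nhds xb. xb $ i \<noteq> 0 \<longrightarrow> x $ i \<noteq> 0" by (cases "xb $ i = 0") auto
qed

text \<open>Points near \<open>xb\<close> have at least the support of \<open>xb\<close>. If it is strictly larger, the derivative of
  the power term at a small nonzero entry exceeds any bound, while the quadratic part is bounded.\<close>
lemma min_subgrad_blowup:
  assumes p: "0 < p" "p < 1" and \<mu>: "0 < \<mu>"
  shows "\<forall>\<^sub>F x in nhds xb. supp x = supp xb \<or> M \<le> norm (min_subgrad A b \<mu> p x)"
proof -
  let ?q = "\<lambda>x. (2 *\<^sub>R (transpose A *v (A *v x - b)))"
  have coord: "\<forall>\<^sub>F x in nhds xb. xb $ i = 0 \<longrightarrow> x $ i \<noteq> 0 \<longrightarrow> M \<le> \<bar>formal_grad A b \<mu> p x $ i\<bar>" for i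
  proof (cases "xb $ i = 0")
    case True
    define C where "C = \<bar>?q xb $ i\<bar> + 1"
    have "isCont ?q xb"
      by (intro continuous_intros bounded_linear.continuous[OF matrix_vector_mul_bounded_linear])
    from isCont_tendsto_nhds[OF this] have "((\<lambda>x. \<bar>?q x $ i\<bar>) \<longlongrightarrow> \<bar>?q xb $ i\<bar>) (nhds xb)" by (intro tendsto_rabs tendsto_vec_nth)
    hence C: "\<forall>\<^sub>F x in nhds xb. \<bar>?q x $ i\<bar> < C" by (rule order_tendstoD(2)) (simp add: C_def)
    have "((\<lambda>y. y $ i) \<longlongrightarrow> xb $ i) (nhds xb)" by (intro tendsto_intros filterlim_ident)
    hence lim: "filterlim (\<lambda>y. y $ i) (nhds 0) (nhds xb)" using True by simp
    have "\<forall>\<^sub>F x in nhds xb. x $ i \<noteq> 0 \<longrightarrow> (M + C) / (\<mu> * p) \<le> \<bar>x $ i\<bar> powr (p - 1)"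
      by (rule eventually_compose_filterlim[OF abs_powr_neg_blowup[OF p(2)] lim])
    with C show ?thesis
    proof eventually_elim
      case (elim x)
      show ?case
      proof (intro impI)
        assume x: "x $ i \<noteq> 0"
        define s where "s = \<mu> * (p * (sgn (x $ i) * \<bar>x $ i\<bar> powr (p - 1)))"
        have "M + C \<le> \<mu> * p * \<bar>x $ i\<bar> powr (p - 1)"
          using elim(2) x p \<mu> by (simp add: field_simps)
        also have "\<dots> = \<bar>s\<bar>" using x p \<mu> by (simp add: s_def abs_mult sgn_if)
        finally have "M + C \<le> \<bar>s\<bar>" .
        moreover have "formal_grad A b \<mu> p x $ i = ?q x $ i + s"
          by (simp add: formal_grad_def s_def)
        ultimately show "M \<le> \<bar>formal_grad A b \<mu> p x $ i\<bar>" using elim(1) by linarith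
      qed
    qed
  qed simp
  have "\<forall>\<^sub>F x in nhds xb. \<forall>i. xb $ i = 0 \<longrightarrow> x $ i \<noteq> 0 \<longrightarrow> M \<le> \<bar>formal_grad A b \<mu> p x $ i\<bar>"
    by (rule eventually_all_finite) (rule coord)
  with eventually_nonzero_on_supp[of xb] show ?thesis
  proof eventually_elim
    case (elim x)
    show ?case
    proof (cases "supp x = supp xb")
      case False
      then obtain i where i: "xb $ i = 0" "x $ i \<noteq> 0" using elim(1) by (auto simp: supp_def)
      have "M \<le> \<bar>min_subgrad A b \<mu> p x $ i\<bar>" using elim(2) i by (simp add: min_subgrad_def)
      also have "\<dots> \<le> norm (min_subgrad A b \<mu> p x)" by (rule component_le_norm_cart)
      finally show ?thesis by simp
    qed simp
  qed
qed

lemma filterlim_subvector: "filterlim (subvector e) (nhds (subvector e xb)) (nhds xb)"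
  unfolding subvector_def by (intro tendsto_vec_lambda tendsto_vec_nth filterlim_ident)

text \<open>On the coordinate subspace the two KL inequalities are the same statement. At the other points
  near \<open>xb\<close> the value gap is at most \<open>1\<close>, so the required lower bound is at most \<open>\<sigma> / (1 - \<theta>)\<close>,
  and by the blow-up all subgradients are at least that long.\<close>
lemma KL_with_modulus_lp_least_squares_reduction:
  fixes e :: "'k::finite \<Rightarrow> 'n::finite"
  assumes p: "0 < p" "p < 1" and \<mu>: "0 < \<mu>" and e: "inj e" "range e = supp xb" and \<theta>: "0 \<le> \<theta>" "\<theta> < 1"
  shows "KL_with_modulus (lp_least_squares A b \<mu> p) xb \<theta> \<sigma> \<longleftrightarrow>
    KL_with_modulus (lp_least_squares (column_submatrix e A) b \<mu> p) (subvector e xb) \<theta> \<sigma>"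
proof -
  define F where "F = lp_least_squares A b \<mu> p"
  define FI where "FI = lp_least_squares (column_submatrix e A) b \<mu> p"
  define P where "P = (\<lambda>x. F xb < F x \<longrightarrow>
      \<sigma> / (1 - \<theta>) * (F x - F xb) powr \<theta> \<le> norm (min_subgrad A b \<mu> p x))"
  define PI where "PI = (\<lambda>y. FI (subvector e xb) < FI y \<longrightarrow>
      \<sigma> / (1 - \<theta>) * (FI y - FI (subvector e xb)) powr \<theta>
        \<le> norm (min_subgrad (column_submatrix e A) b \<mu> p y))"
  have xb: "zero_extend e (subvector e xb) = xb" using e by (simp add: zero_extend_subvector)
  have F: "F (zero_extend e y) = FI y" for y
    by (simp add: F_def FI_def lp_least_squares_zero_extend[OF e(1)])
  have PP: "P (zero_extend e y) \<longleftrightarrow> PI y" for y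
    using F[of y] F[of "subvector e xb"]
    by (simp add: P_def PI_def xb norm_min_subgrad_zero_extend[OF e(1)])
  have KL: "KL_with_modulus F xb \<theta> \<sigma> \<longleftrightarrow> 0 < \<sigma> \<and> eventually P (nhds xb)"
    unfolding P_def F_def KL_with_modulus_iff_eventually[OF isCont_lp_least_squares[OF p(1)]]
      edist_limiting_subdiff_lp_least_squares[OF p(2) \<mu>] by simp
  have KLI: "KL_with_modulus FI (subvector e xb) \<theta> \<sigma> \<longleftrightarrow>
      0 < \<sigma> \<and> eventually PI (nhds (subvector e xb))"
    unfolding PI_def FI_def KL_with_modulus_iff_eventually[OF isCont_lp_least_squares[OF p(1)]]
      edist_limiting_subdiff_lp_least_squares[OF p(2) \<mu>] by simp
  have "eventually PI (nhds (subvector e xb))" if "eventually P (nhds xb)"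
  proof -
    have "isCont (zero_extend e) (subvector e xb)"
      using linear_zero_extend[OF e(1)] by (rule linear_continuous_at[OF linear_conv_bounded_linear[THEN iffD1]])
    from isCont_tendsto_nhds[OF this]
    have "filterlim (zero_extend e) (nhds xb) (nhds (subvector e xb))" by (simp add: xb)
    from eventually_compose_filterlim[OF that this] show ?thesis by (simp add: PP)
  qed
  moreover have "eventually P (nhds xb)" if PI: "eventually PI (nhds (subvector e xb))" and \<sigma>: "0 < \<sigma>"
  proof -
    have "(F \<longlongrightarrow> F xb) (nhds xb)"
      unfolding F_def by (intro isCont_tendsto_nhds isCont_lp_least_squares p)
    hence "\<forall>\<^sub>F x in nhds xb. F x < F xb + 1" by (rule order_tendstoD(2)) simp
    with eventually_compose_filterlim[OF PI filterlim_subvector]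
      min_subgrad_blowup[OF p \<mu>, of xb "\<sigma> / (1 - \<theta>)" A b]
    show ?thesis
    proof eventually_elim
      case (elim x)
      show "P x"
      proof (cases "supp x = supp xb")
        case True
        hence "zero_extend e (subvector e x) = x" using e by (simp add: zero_extend_subvector)
        thus ?thesis using elim(1) PP by metis
      next
        case False
        hence big: "\<sigma> / (1 - \<theta>) \<le> norm (min_subgrad A b \<mu> p x)" using elim(2) by blast
        show ?thesis unfolding P_def
        proof
          assume "F xb < F x"
          hence "(F x - F xb) powr \<theta> \<le> 1" using elim(3) \<theta> by (intro powr_le1) auto
          hence "\<sigma> / (1 - \<theta>) * (F x - F xb) powr \<theta> \<le> \<sigma> / (1 - \<theta>) * 1"
            using \<sigma> \<theta> by (intro mult_left_mono) auto
          thus "\<sigma> / (1 - \<theta>) * (F x - F xb) powr \<theta> \<le> norm (min_subgrad A b \<mu> p x)"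
            using big by simp
        qed
      qed
    qed
  qed
  ultimately show ?thesis using KL KLI unfolding F_def FI_def by blast
qed

text \<open>Points with larger support contribute only unbounded subgradients, and points with the same
  support do not have larger values.\<close>
lemma outer_limiting_subdiff_lp_least_squares_empty:
  fixes e :: "'k::finite \<Rightarrow> 'n::finite"
  assumes p: "0 < p" "p < 1" and \<mu>: "0 < \<mu>" and e: "inj e" "range e = supp xb"
    and max: "\<forall>\<^sub>F y in nhds (subvector e xb). lp_least_squares (column_submatrix e A) b \<mu> p y
                \<le> lp_least_squares (column_submatrix e A) b \<mu> p (subvector e xb)"
  shows "outer_limiting_subdiff (lp_least_squares A b \<mu> p) xb = {}"
proof (rule equals0I)
  fix v assume "v \<in> outer_limiting_subdiff (lp_least_squares A b \<mu> p) xb"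
  then obtain X V where X: "X \<longlonglongrightarrow> xb" and V: "V \<longlonglongrightarrow> v" and
    gt: "\<And>k. lp_least_squares A b \<mu> p xb < lp_least_squares A b \<mu> p (X k)" and
    sub: "\<And>k. V k \<in> limiting_subdiff (lp_least_squares A b \<mu> p) (X k)"
    unfolding outer_limiting_subdiff_def by blast
  have "(\<lambda>k. norm (V k)) \<longlonglongrightarrow> norm v" using V by (rule tendsto_norm)
  hence "\<forall>\<^sub>F k in sequentially. norm (V k) < norm v + 1" by (rule order_tendstoD(2)) simp
  with eventually_compose_filterlim[OF min_subgrad_blowup[OF p \<mu>] X, of "norm v + 1" A b]
    eventually_compose_filterlim[OF eventually_compose_filterlim[OF max filterlim_subvector] X]
  have "\<forall>\<^sub>F k in sequentially. False"
  proof eventually_elim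
    case (elim k)
    have "norm (min_subgrad A b \<mu> p (X k)) < norm v + 1"
      using min_subgrad_least_norm[OF p(2) \<mu> sub, of k] elim(3) by linarith
    hence "supp (X k) = supp xb" using elim(1) by linarith
    hence "zero_extend e (subvector e (X k)) = X k" "zero_extend e (subvector e xb) = xb"
      using e by (simp_all add: zero_extend_subvector)
    thus False
      using gt[of k] elim(2) lp_least_squares_zero_extend[OF e(1), of A b \<mu> p] by (metis not_less)
  qed
  thus False by simp
qed

section \<open>Gradient and Hessian at points of full support\<close>

lemma gradient_eqI: "GDERIV f x :> D \<Longrightarrow> gradient f x = D"
  for f :: "'a::real_inner \<Rightarrow> real"
proof -
  assume D: "GDERIV f x :> D"
  have "D' = D" if "GDERIV f x :> D'" for D'
  proof -
    have "(\<lambda>h. h \<bullet> D') = (\<lambda>h. h \<bullet> D)"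
      using that D unfolding gderiv_def by (rule has_derivative_unique)
    hence "h \<bullet> (D' - D) = 0" for h by (simp add: inner_diff_right fun_eq_iff)
    thus ?thesis by (metis inner_eq_zero_iff right_minus_eq)
  qed
  thus ?thesis unfolding gradient_def using D by blast
qed

text \<open>The Hessian, as a linear operator, at a point without zero entries.\<close>
definition formal_hess :: "real^'n^'m \<Rightarrow> real \<Rightarrow> real \<Rightarrow> real^'n \<Rightarrow> real^'n \<Rightarrow> real^'n" where
  "formal_hess A \<mu> p x h = 2 *\<^sub>R (transpose A *v (A *v h))
     + \<mu> *\<^sub>R (\<chi> i. p * ((p - 1) * \<bar>x $ i\<bar> powr (p - 2) * h $ i))"

lemma formal_hess_selfadjoint: "formal_hess A \<mu> p x h \<bullet> k = h \<bullet> formal_hess A \<mu> p x k"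
proof -
  have "(transpose A *v (A *v h)) \<bullet> k = h \<bullet> (transpose A *v (A *v k))"
    by (metis inner_commute inner_transpose_mult)
  moreover have "(\<chi> i. p * ((p - 1) * \<bar>x $ i\<bar> powr (p - 2) * h $ i)) \<bullet> k
      = h \<bullet> (\<chi> i. p * ((p - 1) * \<bar>x $ i\<bar> powr (p - 2) * k $ i))"
    by (simp add: inner_vec_def mult_ac)
  ultimately show ?thesis
    by (simp add: formal_hess_def inner_add_left inner_add_right del: transpose_matrix_vector)
qed

lemma formal_grad_has_derivative:
  assumes "\<And>i. x $ i \<noteq> 0"
  shows "(formal_grad A b \<mu> p has_derivative formal_hess A \<mu> p x) (at x)"
proof -
  have A: "((\<lambda>y. A *v y - b) has_derivative (\<lambda>h. A *v h)) (at x)"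
    using bounded_linear_imp_has_derivative[OF matrix_vector_mul_bounded_linear[of A]]
    by (auto intro!: derivative_eq_intros)
  have q: "((\<lambda>y. transpose A *v (A *v y - b)) has_derivative (\<lambda>h. transpose A *v (A *v h))) (at x)"
    by (rule bounded_linear.has_derivative[OF matrix_vector_mul_bounded_linear A])
  have coord: "((\<lambda>y. p * (sgn (y $ i) * \<bar>y $ i\<bar> powr (p - 1))) has_derivative
      (\<lambda>h. p * ((p - 1) * \<bar>x $ i\<bar> powr (p - 2) * h $ i))) (at x)" for i
  proof (rule has_derivative_mult_right)
    have nth: "((\<lambda>y. y $ i) has_derivative (\<lambda>h. h $ i)) (at x)"
      by (rule bounded_linear_imp_has_derivative[OF bounded_linear_vec_nth])
    from has_derivative_compose[OF nth sgn_abs_powr_has_real_derivative[OF assms, of "p - 1",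
        unfolded has_field_derivative_def]]
    show "((\<lambda>y. sgn (y $ i) * \<bar>y $ i\<bar> powr (p - 1)) has_derivative
        (\<lambda>h. (p - 1) * \<bar>x $ i\<bar> powr (p - 2) * h $ i)) (at x)" by simp
  qed
  have "((\<lambda>y. \<chi> i. p * (sgn (y $ i) * \<bar>y $ i\<bar> powr (p - 1))) has_derivative
      (\<lambda>h. \<chi> i. p * ((p - 1) * \<bar>x $ i\<bar> powr (p - 2) * h $ i))) (at x)"
    by (subst has_derivative_componentwise_within) (auto simp: Basis_vec_def inner_axis coord)
  thus ?thesis
    unfolding formal_grad_def[abs_def] formal_hess_def[abs_def]
    by (intro has_derivative_add has_derivative_scaleR_right q)
qed

lemma full_support_gderiv:
  assumes "\<And>i. xb $ i \<noteq> 0"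
  shows "\<forall>\<^sub>F x in nhds xb. GDERIV (lp_least_squares A b \<mu> p) x :> formal_grad A b \<mu> p x"
  using eventually_nonzero_on_supp[of xb]
proof eventually_elim
  case (elim x)
  hence "UNIV = supp x" using assms by (auto simp: supp_def)
  moreover have "lp_least_squares A b \<mu> p = support_objective A b \<mu> p UNIV"
    by (rule ext) (subst lp_least_squares_split[of _ _ _ _ _ UNIV], simp)
  ultimately show ?case using support_objective_gderiv[of UNIV x A b \<mu> p] by simp
qed

lemma full_support_min_subgrad:
  assumes "\<And>i. xb $ i \<noteq> 0"
  shows "\<forall>\<^sub>F x in nhds xb. min_subgrad A b \<mu> p x = formal_grad A b \<mu> p x"
  using eventually_nonzero_on_supp[of xb]
  by eventually_elim (use assms in \<open>simp add: min_subgrad_def vec_eq_iff\<close>)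

lemma hessian_lp_least_squares_mult:
  assumes "\<And>i. xb $ i \<noteq> 0"
  shows "hessian (lp_least_squares A b \<mu> p) xb *v h = formal_hess A \<mu> p xb h"
proof -
  have ev: "\<forall>\<^sub>F x in nhds xb. formal_grad A b \<mu> p x = gradient (lp_least_squares A b \<mu> p) x"
    using full_support_gderiv[OF assms, of A b \<mu> p] by eventually_elim (simp add: gradient_eqI)
  have d: "(gradient (lp_least_squares A b \<mu> p) has_derivative formal_hess A \<mu> p xb) (at xb)"
    using formal_grad_has_derivative[OF assms, of A b \<mu> p]
    by (rule has_derivative_transform_eventually)
      (use ev eventually_nhds_x_imp_x[OF ev] in \<open>auto simp: eventually_at_filter elim: eventually_mono\<close>)
  have "linear (formal_hess A \<mu> p xb)" using d by (rule has_derivative_linear)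
  thus ?thesis
    unfolding hessian_def jacobian_def frechet_derivative_at[OF d, symmetric]
    by (metis matrix_vector_mul(2))
qed

section \<open>KL exponents of the regularized least squares objective\<close>

theorem proposition5p4:
  fixes A :: "real^'n^'m" and b :: "real^'m" and \<mu> p :: real
    and xb :: "real^'n" and e :: "'k::finite \<Rightarrow> 'n"
    and F :: "real^'n \<Rightarrow> real" and F\<^sub>I :: "real^'k \<Rightarrow> real" and xb\<^sub>I :: "real^'k"
  assumes "0 < p" and "p < 1" and "\<mu> > 0"
    and F_def: "F = lp_least_squares A b \<mu> p"
    and "xb \<noteq> 0"
    and e: "inj e" "range e = supp xb"
    and xI_def: "xb\<^sub>I = subvector e xb"
    and FI_def: "F\<^sub>I = lp_least_squares (column_submatrix e A) b \<mu> p"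
  shows "(\<forall>\<theta>\<in>{0..<1}. KL F xb \<theta> = KL F\<^sub>I xb\<^sub>I \<theta>) \<and>
    (gradient F\<^sub>I xb\<^sub>I = 0 \<and> negative_definite (hessian F\<^sub>I xb\<^sub>I) \<longrightarrow>
       outer_limiting_subdiff F xb = {} \<and>
       KL_property F xb 0 \<and> \<not> sharp_KL_exponent F xb 0) \<and>
    (gradient F\<^sub>I xb\<^sub>I = 0 \<and>
     (positive_definite (hessian F\<^sub>I xb\<^sub>I) \<or>
      indefinite (hessian F\<^sub>I xb\<^sub>I) \<and> invertible (hessian F\<^sub>I xb\<^sub>I)) \<longrightarrow>
       sharp_KL_exponent F xb (1/2) \<and>
       KL F xb (1/2) = ereal (sqrt (smallest_pos_eigenvalue (hessian F\<^sub>I xb\<^sub>I) / 2)))"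
proof -
  note p = \<open>0 < p\<close> \<open>p < 1\<close> and \<mu> = \<open>\<mu> > 0\<close>
  define H where "H = hessian F\<^sub>I xb\<^sub>I"
  define G where "G = formal_grad (column_submatrix e A) b \<mu> p"
  have full: "xb\<^sub>I $ j \<noteq> 0" for j
    using e(2) by (auto simp: xI_def subvector_def supp_def)
  have red: "KL_with_modulus F xb \<theta> \<sigma> \<longleftrightarrow> KL_with_modulus F\<^sub>I xb\<^sub>I \<theta> \<sigma>" if "0 \<le> \<theta>" "\<theta> < 1" for \<theta> \<sigma>
    unfolding F_def FI_def xI_def by (rule KL_with_modulus_lp_least_squares_reduction[OF p \<mu> e that])
  have cont: "isCont F\<^sub>I xb\<^sub>I" unfolding FI_def by (rule isCont_lp_least_squares[OF p(1)])
  have grad: "\<forall>\<^sub>F y in nhds xb\<^sub>I. GDERIV F\<^sub>I y :> G y"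
    unfolding FI_def G_def by (rule full_support_gderiv[OF full])
  have dist: "\<forall>\<^sub>F y in nhds xb\<^sub>I. edist_set 0 (limiting_subdiff F\<^sub>I y) = ereal (norm (G y))"
    using full_support_min_subgrad[OF full, of "column_submatrix e A" b \<mu> p]
    unfolding FI_def G_def
    by eventually_elim (simp add: edist_limiting_subdiff_lp_least_squares[OF p(2) \<mu>])
  have Hmul: "(*v) H = formal_hess (column_submatrix e A) \<mu> p xb\<^sub>I"
    unfolding H_def FI_def by (rule ext) (rule hessian_lp_least_squares_mult[OF full])
  have der: "(G has_derivative (*v) H) (at xb\<^sub>I)"
    unfolding Hmul G_def by (rule formal_grad_has_derivative[OF full])
  have sym: "(H *v x) \<bullet> y = x \<bullet> (H *v y)" for x y
    unfolding Hmul by (rule formal_hess_selfadjoint)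
  have G0: "G xb\<^sub>I = 0" if "gradient F\<^sub>I xb\<^sub>I = 0"
    using gradient_eqI[OF eventually_nhds_x_imp_x[OF grad]] that by simp
  have linH: "linear ((*v) H)" by simp

  have a: "KL F xb \<theta> = KL F\<^sub>I xb\<^sub>I \<theta>" if "\<theta> \<in> {0..<1}" for \<theta>
    using red[of \<theta>] that by (simp add: KL_def)

  have b: "outer_limiting_subdiff F xb = {} \<and> KL_property F xb 0 \<and> \<not> sharp_KL_exponent F xb 0"
    if crit: "gradient F\<^sub>I xb\<^sub>I = 0" and neg: "negative_definite H"
  proof -
    have max: "\<forall>\<^sub>F y in nhds xb\<^sub>I. F\<^sub>I y \<le> F\<^sub>I xb\<^sub>I"
      by (rule negative_definite_critical_local_max[OF grad der G0[OF crit] sym])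
        (use neg in \<open>simp add: negative_definite_def\<close>)
    have "\<forall>\<^sub>F y in nhds xb\<^sub>I. F\<^sub>I xb\<^sub>I < F\<^sub>I y \<longrightarrow>
        ereal (1 / (1 - 0) * (F\<^sub>I y - F\<^sub>I xb\<^sub>I) powr 0) \<le> edist_set 0 (limiting_subdiff F\<^sub>I y)"
      using max by (rule eventually_mono) auto
    hence "KL_with_modulus F\<^sub>I xb\<^sub>I 0 1"
      unfolding KL_with_modulus_iff_eventually[OF cont] by simp
    hence "KL_property F xb 0" using red[of 0] unfolding KL_property_def by auto
    moreover have "outer_limiting_subdiff F xb = {}"
      unfolding F_def
      by (rule outer_limiting_subdiff_lp_least_squares_empty[OF p \<mu> e])
        (use max in \<open>simp add: FI_def xI_def\<close>)
    ultimately show ?thesis by (simp add: sharp_KL_exponent_def)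
  qed

  have c: "sharp_KL_exponent F xb (1/2) \<and>
      KL F xb (1/2) = ereal (sqrt (smallest_pos_eigenvalue H / 2))"
    if crit: "gradient F\<^sub>I xb\<^sub>I = 0"
      and nondeg: "positive_definite H \<or> indefinite H \<and> invertible H"
  proof -
    obtain z where z: "0 < z \<bullet> (H *v z)"
      using nondeg
      by (metis positive_definite_def indefinite_def axis_eq_0_iff zero_neq_one)
    have inj: "inj ((*v) H)"
      using nondeg
    proof
      assume "positive_definite H"
      hence "x = 0" if "H *v x = 0" for x
        using that unfolding positive_definite_def by (metis inner_zero_right less_irrefl)
      thus ?thesis using linear_injective_0[OF linH] by blast
    next
      assume "indefinite H \<and> invertible H"
      thus ?thesis
        by (metis invertible_def matrix_left_invertible_injective)
    qed
    define E where "E = {l. eigenvalue_of H l \<and> l > 0}"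
    define \<kappa> where "\<kappa> = Min E"
    have fin: "finite E"
      using selfadjoint_finite_eigenvalues[of "(*v) H", OF sym]
      unfolding E_def eigenvalue_of_def by (rule rev_finite_subset) auto
    obtain v0 l0 where "v0 \<noteq> 0" "H *v v0 = l0 *\<^sub>R v0" "0 < l0"
      by (rule selfadjoint_positive_eigenvalue_exists[OF linH sym z])
    hence "E \<noteq> {}" unfolding E_def eigenvalue_of_def by blast
    hence "\<kappa> \<in> E" using fin by (simp add: \<kappa>_def)
    then obtain v where v: "v \<noteq> 0" "H *v v = \<kappa> *\<^sub>R v" "0 < \<kappa>"
      unfolding E_def eigenvalue_of_def by blast
    have gap: "H *v w \<noteq> l *\<^sub>R w" if "0 < l" "l < \<kappa>" "w \<noteq> 0" for l w
    proof
      assume "H *v w = l *\<^sub>R w"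
      hence "l \<in> E" using that unfolding E_def eigenvalue_of_def by blast
      thus False using Min_le[OF fin] that(2) by (force simp: \<kappa>_def)
    qed
    define s where "s = sqrt (\<kappa> / 2)"
    have s: "0 < s" using v(3) by (simp add: s_def)
    have low: "KL_with_modulus F xb (1/2) \<sigma>" if "0 < \<sigma>" "\<sigma> < s" for \<sigma>
      using KL_half_modulus_at_nondegenerate_critical_point[OF cont grad dist der G0[OF crit] sym inj
          v(3) gap that[unfolded s_def]] red[of "1/2"] by simp
    have up: "\<theta> = 1/2 \<and> \<sigma> \<le> s" if "KL_with_modulus F xb \<theta> \<sigma>" "0 \<le> \<theta>" "\<theta> \<le> 1/2" for \<theta> \<sigma>
      using KL_modulus_bound_along_eigenvector[OF cont grad dist der G0[OF crit] v _ that(2,3), of \<sigma>]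
        red[of \<theta> \<sigma>] that by (simp add: s_def)
    have "KL_property F xb (1/2)" unfolding KL_property_def using low[of "s/2"] s by auto
    moreover have "\<not> KL_property F xb \<theta>" if "\<theta> \<in> {0..<1/2}" for \<theta>
      using up[of \<theta>] that unfolding KL_property_def by force
    ultimately have "sharp_KL_exponent F xb (1/2)" by (simp add: sharp_KL_exponent_def)
    moreover have "KL F xb (1/2) = ereal s"
      unfolding KL_def by (rule Sup_open_initial_moduli[OF s low]) (use up in auto)
    moreover have "smallest_pos_eigenvalue H = \<kappa>"
      by (simp add: smallest_pos_eigenvalue_def \<kappa>_def E_def)
    ultimately show ?thesis by (simp add: s_def)
  qed
  show ?thesis using a b c unfolding H_def by blast
qed

end
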